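(* For all positive integers $m$ and $n$, $$P_{m,n}(y,q)=\left\langle C_{m,n}(\mathbf{x}+y;q),\,\frac{1}{1-p_1(\mathbf{x})}\right\rangle.$$ Equivalently, for every integer $k$ with $0\leq k\leq n$, $$P_{m,n}^{(k)}(q)=\left\langle C_{m,n}(\mathbf{x};q),\,p_1(\mathbf{x})^{n-k}\,h_k(\mathbf{x})\right\rangle.$$
   Context: For positive integers $m,n$, an $(m,n)$-Schröder path is a sequence of points $(u,v)\in\mathbb{N}\times\mathbb{N}$ starting at $(0,0)$ and ending at $(m,n)$, all satisfying $mv-nu\geq 0$, in which each next point is obtained by adding $(0,1)$ (up step), $(1,1)$ (diagonal step) or $(1,0)$ (right step). For such a path $\alpha$, $\mathrm{diag}(\alpha)$ is the number of its diagonal steps, and $\gamma(\alpha)$ is the list of the lengths of its risers, i.e. of its maximal sequences of consecutive up steps. The weight of $\alpha$ is $\alpha(\mathbf{x}):=\prod_{k\in\gamma(\alpha)}e_k(\mathbf{x})$ (product with multiplicity, equal to $1$ if there is no riser). Area: for $0\leq i\leq n-1$ let $|a_i|$ be the $x$-coordinate of the starting point of the unique up or diagonal step of $\alpha$ that goes from height $i$ to height $i+1$. Set $\mathrm{area}(\alpha):=\sum_{i=0}^{n-1}\left(\lfloor i\,m/n\rfloor-|a_i|\right)$. An $(m,n)$-Schröder parking function of shape $\alpha$ is a bijective labeling of the up steps of the $(m,n)$-Schröder path $\alpha$ by the elements of $\{1,2,\ldots,n-\mathrm{diag}(\alpha)\}$ such that consecutive up steps with the same $x$-coordinate have decreasing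 labels when read from top to bottom. $\mathbb{P}(\alpha)$ denotes the set of parking functions of shape $\alpha$. Define $$P_{m,n}(y,q)=\sum_k P_{m,n}^{(k)}(q)\,y^k:=\sum_{\alpha}|\mathbb{P}(\alpha)|\,q^{\mathrm{area}(\alpha)}\,y^{\mathrm{diag}(\alpha)},\qquad C_{m,n}(\mathbf{x};q):=\sum_{\mathrm{diag}(\alpha)=0}\alpha(\mathbf{x})\,q^{\mathrm{area}(\alpha)},$$ with sums over $(m,n)$-Schröder paths $\alpha$ (with no diagonal step in the second case). Here $e_k$, $h_k$, $p_k$ are the elementary, complete homogeneous and power sum symmetric functions in $\mathbf{x}=x_1,x_2,\ldots$ (with $e_0=h_0=1$). For a symmetric function $f$, $f(\mathbf{x}+y)$ denotes $f$ evaluated on the variables $\mathbf{x}$ enlarged by one new variable $y$. The scalar product is the usual (Hall) one on symmetric functions in $\mathbf{x}$, extended linearly over $\mathbb{Q}[q,y]$: $\langle p_\mu,p_\nu\rangle=z_\mu\,\delta_{\mu,\nu}$, where $z_\mu=\prod_i i^{d_i}d_i!$ with $d_i$ the number of parts of $\mu$ equal to $i$. The expression $\frac{1}{1-p_1(\mathbf{x})}$ stands for $\sum_{j\geq0}p_1(\mathbf{x})^j$; in its scalar product with a symmetric function of bounded degree only finitely many terms are nonzero. *)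

theory Defs
  imports
    "HOL-Computational_Algebra.Polynomial"
    "HOL-Library.Multiset"
    "HOL-Library.FuncSet"
    "HOL-Library.Product_Plus"
    "HOL-Library.Groups_Big_Fun"
begin

section \<open>Schroeder paths\<close>

definition schroeder_paths :: "nat \<Rightarrow> nat \<Rightarrow> (nat \<times> nat) list set" where
  "schroeder_paths m n = {ps. ps \<noteq> [] \<and> hd ps = (0, 0) \<and> last ps = (m, n) \<and>
     (\<forall>(u, v) \<in> set ps. int m * int v - int n * int u \<ge> 0) \<and>
     (\<forall>i. Suc i < length ps \<longrightarrow> ps ! Suc i \<in> {ps ! i + (0, 1), ps ! i + (1, 1), ps ! i + (1, 0)})}"

text \<open>A step is identified with the position in the list of its starting point.\<close>

definition up_steps :: "(nat \<times> nat) list \<Rightarrow> nat set" where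
  "up_steps ps = {i. Suc i < length ps \<and> ps ! Suc i = ps ! i + (0, 1)}"

definition diag_steps :: "(nat \<times> nat) list \<Rightarrow> nat set" where
  "diag_steps ps = {i. Suc i < length ps \<and> ps ! Suc i = ps ! i + (1, 1)}"

definition diag :: "(nat \<times> nat) list \<Rightarrow> nat" where
  "diag ps = card (diag_steps ps)"

text \<open>The pair \<open>(i, j)\<close> stands for the maximal run of up steps \<open>i, \<dots>, j - 1\<close>.\<close>

definition risers :: "(nat \<times> nat) list \<Rightarrow> (nat \<times> nat) set" where
  "risers ps = {(i, j). i < j \<and> {i..<j} \<subseteq> up_steps ps \<and>
     (i = 0 \<or> i - 1 \<notin> up_steps ps) \<and> j \<notin> up_steps ps}"

definition riser_lengths :: "(nat \<times> nat) list \<Rightarrow> nat multiset" where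
  "riser_lengths ps = image_mset (\<lambda>(i, j). j - i) (mset_set (risers ps))"

definition row_start :: "(nat \<times> nat) list \<Rightarrow> nat \<Rightarrow> nat" where
  "row_start ps i = (THE u. \<exists>j \<in> up_steps ps \<union> diag_steps ps. ps ! j = (u, i))"

text \<open>The subtraction on \<^typ>\<open>nat\<close> is exact here: the step leaving height \<open>i\<close> starts at a point
  \<open>(u, i)\<close> with \<open>n * u \<le> m * i\<close>.\<close>

definition area :: "nat \<Rightarrow> nat \<Rightarrow> (nat \<times> nat) list \<Rightarrow> nat" where
  "area m n ps = (\<Sum>i<n. (i * m) div n - row_start ps i)"

text \<open>Consecutive up steps automatically have the same abscissa; labels decreasing from top to
  bottom are labels increasing along the path. Labelings are undefined off the up steps, so that
  their number is meaningful.\<close>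

definition parking_functions :: "nat \<Rightarrow> (nat \<times> nat) list \<Rightarrow> (nat \<Rightarrow> nat) set" where
  "parking_functions n ps = {l \<in> extensional (up_steps ps).
     bij_betw l (up_steps ps) {1..n - diag ps} \<and>
     (\<forall>i. i \<in> up_steps ps \<and> Suc i \<in> up_steps ps \<longrightarrow> l i < l (Suc i))}"

text \<open>The outer polynomial variable is \<open>y\<close>, the inner one is \<open>q\<close>.\<close>

definition qvar :: "rat poly" where "qvar = monom 1 1"

definition yvar :: "rat poly poly" where "yvar = monom 1 1"

definition P_poly :: "nat \<Rightarrow> nat \<Rightarrow> rat poly poly" where
  "P_poly m n = (\<Sum>ps \<in> schroeder_paths m n.
     of_nat (card (parking_functions n ps)) * [:qvar:] ^ area m n ps * yvar ^ diag ps)"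


section \<open>Formal power series in countably many variables\<close>

text \<open>The multiset \<open>M\<close> stands for the monomial \<open>\<Prod>i \<in># M. x\<^sub>i\<close> in the variables
  \<open>x\<^sub>0, x\<^sub>1, \<dots>\<close>, and \<open>mcoeff f M\<close> is its coefficient in \<open>f\<close>.\<close>

typedef 'a mseries = "UNIV :: (nat multiset \<Rightarrow> 'a) set"
  morphisms mcoeff Abs_mseries ..

setup_lifting type_definition_mseries

lemma mseries_eqI: "(\<And>M. mcoeff f M = mcoeff g M) \<Longrightarrow> f = g"
  by (metis mcoeff_inject ext)

definition splits :: "'b multiset \<Rightarrow> ('b multiset \<times> 'b multiset) set" where
  "splits M = {(A, B). A + B = M}"

lemma finite_splits [simp]: "finite (splits M)"
proof -
  have "finite {A. A \<subseteq># M}"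
  proof (induction M)
    case (add x M)
    have "{A. A \<subseteq># add_mset x M} \<subseteq> {A. A \<subseteq># M} \<union> add_mset x ` {A. A \<subseteq># M}"
    proof
      fix A assume "A \<in> {A. A \<subseteq># add_mset x M}"
      then have A: "A \<subseteq># add_mset x M" by simp
      show "A \<in> {A. A \<subseteq># M} \<union> add_mset x ` {A. A \<subseteq># M}"
      proof (cases "x \<in># A")
        case True
        then obtain B where B: "A = add_mset x B" by (metis mset_add)
        with A have "B \<subseteq># M" by simp
        with B show ?thesis by blast
      next
        case False
        with A have "A \<subseteq># M"
          by (metis diff_single_trivial add_mset_remove_trivial subset_eq_diff_conv
              add_mset_add_single)
        then show ?thesis by blast
      qed
    qed
    then show ?case using add.IH finite_subset by blast
  qed simp
  then have "finite ((\<lambda>A. (A, M - A)) ` {A. A \<subseteq># M})" by simp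
  moreover have "splits M \<subseteq> (\<lambda>A. (A, M - A)) ` {A. A \<subseteq># M}"
    by (auto simp: splits_def)
  ultimately show ?thesis by (rule finite_subset[rotated])
qed

instantiation mseries :: (comm_ring_1) comm_ring_1
begin

lift_definition zero_mseries :: "'a mseries" is "\<lambda>_. 0" .
lift_definition one_mseries :: "'a mseries" is "\<lambda>M. if M = {#} then 1 else 0" .
lift_definition plus_mseries :: "'a mseries \<Rightarrow> 'a mseries \<Rightarrow> 'a mseries" is "\<lambda>f g M. f M + g M" .
lift_definition minus_mseries :: "'a mseries \<Rightarrow> 'a mseries \<Rightarrow> 'a mseries" is "\<lambda>f g M. f M - g M" .
lift_definition uminus_mseries :: "'a mseries \<Rightarrow> 'a mseries" is "\<lambda>f M. - f M" .
lift_definition times_mseries :: "'a mseries \<Rightarrow> 'a mseries \<Rightarrow> 'a mseries" is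
  "\<lambda>f g M. \<Sum>(A, B) \<in> splits M. f A * g B" .

instance
proof
  fix a b c :: "'a mseries"
  show "a * b * c = a * (b * c)"
  proof (rule mseries_eqI)
    fix M
    have "mcoeff (a * b * c) M =
      (\<Sum>p \<in> splits M. \<Sum>r \<in> splits (fst p). mcoeff a (fst r) * mcoeff b (snd r) * mcoeff c (snd p))"
      by (simp add: times_mseries.rep_eq sum_distrib_right case_prod_unfold)
    also have "\<dots> = (\<Sum>(p, r) \<in> (SIGMA p:splits M. splits (fst p)).
        mcoeff a (fst r) * mcoeff b (snd r) * mcoeff c (snd p))"
      by (subst sum.Sigma) auto
    also have "\<dots> = (\<Sum>(p, r) \<in> (SIGMA p:splits M. splits (snd p)).
        mcoeff a (fst p) * (mcoeff b (fst r) * mcoeff c (snd r)))"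
      by (rule sum.reindex_bij_witness[where
            i = "\<lambda>(p, r). ((fst p + fst r, snd r), (fst p, fst r))" and
            j = "\<lambda>(p, r). ((fst r, snd r + snd p), (snd r, snd p))"])
        (auto simp: splits_def ac_simps)
    also have "\<dots> = (\<Sum>p \<in> splits M. \<Sum>r \<in> splits (snd p).
        mcoeff a (fst p) * (mcoeff b (fst r) * mcoeff c (snd r)))"
      by (subst sum.Sigma) auto
    also have "\<dots> = mcoeff (a * (b * c)) M"
      by (simp add: times_mseries.rep_eq sum_distrib_left case_prod_unfold)
    finally show "mcoeff (a * b * c) M = mcoeff (a * (b * c)) M" .
  qed
  show "a * b = b * a"
  proof (rule mseries_eqI)
    fix M
    show "mcoeff (a * b) M = mcoeff (b * a) M"
      unfolding times_mseries.rep_eq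
      by (rule sum.reindex_bij_witness[where i = prod.swap and j = prod.swap])
        (auto simp: splits_def ac_simps)
  qed
  show "1 * a = a"
  proof (rule mseries_eqI)
    fix M
    have "mcoeff (1 * a) M = (\<Sum>p \<in> splits M. if p = ({#}, M) then mcoeff a M else 0)"
      unfolding times_mseries.rep_eq one_mseries.rep_eq
      by (rule sum.cong) (auto simp: splits_def split: if_splits)
    also have "\<dots> = mcoeff a M"
    proof -
      have "({#}, M) \<in> splits M" by (simp add: splits_def)
      then show ?thesis by simp
    qed
    finally show "mcoeff (1 * a) M = mcoeff a M" .
  qed
  show "(a + b) * c = a * c + b * c"
    by (rule mseries_eqI)
      (simp add: times_mseries.rep_eq plus_mseries.rep_eq distrib_right sum.distrib case_prod_unfold)
  show "(0::'a mseries) \<noteq> 1"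
    by transfer (metis zero_neq_one)
qed (transfer; simp add: algebra_simps)+

end

lift_definition mconst :: "'a::comm_ring_1 \<Rightarrow> 'a mseries" is "\<lambda>c M. if M = {#} then c else 0" .


section \<open>Symmetric functions and their scalar product\<close>

lift_definition elem_sym :: "nat \<Rightarrow> 'a::comm_ring_1 mseries" is
  "\<lambda>k M. if size M = k \<and> (\<forall>i. count M i \<le> 1) then 1 else 0" .

lift_definition homog_sym :: "nat \<Rightarrow> 'a::comm_ring_1 mseries" is
  "\<lambda>k M. if size M = k then 1 else 0" .

text \<open>Only \<open>power_sum k\<close> with \<open>k > 0\<close> is meaningful.\<close>

lift_definition power_sum :: "nat \<Rightarrow> 'a::comm_ring_1 mseries" is
  "\<lambda>k M. if \<exists>i. M = replicate_mset k i then 1 else 0" .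

definition power_sum_mset :: "nat multiset \<Rightarrow> 'a::comm_ring_1 mseries" where
  "power_sum_mset \<mu> = (\<Prod>k\<in>#\<mu>. power_sum k)"

definition partitions_of :: "nat \<Rightarrow> nat multiset set" where
  "partitions_of d = {\<mu>. 0 \<notin># \<mu> \<and> sum_mset \<mu> = d}"

definition zfactor :: "nat multiset \<Rightarrow> nat" where
  "zfactor \<mu> = (\<Prod>i \<in> set_mset \<mu>. i ^ count \<mu> i * fact (count \<mu> i))"

text \<open>\<open>power_sum_coeffs f \<mu>\<close> is the coefficient of \<open>p\<^sub>\<mu>\<close> in the expansion of the symmetric series
  \<open>f\<close> in the basis of power sums. The expansion is taken in each degree separately, so \<open>f\<close> need not
  have bounded degree. It exists and is unique for symmetric \<open>f\<close> whenever the coefficient ring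
  contains the rational numbers.\<close>

definition power_sum_expansion :: "'a::comm_ring_1 mseries \<Rightarrow> (nat multiset \<Rightarrow> 'a) \<Rightarrow> bool" where
  "power_sum_expansion f c \<longleftrightarrow> (\<forall>\<mu>. 0 \<in># \<mu> \<longrightarrow> c \<mu> = 0) \<and>
     (\<forall>M. mcoeff f M = (\<Sum>\<mu> \<in> partitions_of (size M). c \<mu> * mcoeff (power_sum_mset \<mu>) M))"

definition power_sum_coeffs :: "'a::comm_ring_1 mseries \<Rightarrow> nat multiset \<Rightarrow> 'a" where
  "power_sum_coeffs f = (THE c. power_sum_expansion f c)"

text \<open>The bilinear extension of \<open>\<langle>p\<^sub>\<mu>, p\<^sub>\<nu>\<rangle> = z\<^sub>\<mu> \<delta>\<^sub>\<mu>\<^sub>\<nu>\<close>; the sum has finitely many nonzero terms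
  as soon as one of the arguments has bounded degree.\<close>

definition hall_inner :: "'a::comm_ring_1 mseries \<Rightarrow> 'a mseries \<Rightarrow> 'a" where
  "hall_inner f g =
     Sum_any (\<lambda>\<mu>. of_nat (zfactor \<mu>) * power_sum_coeffs f \<mu> * power_sum_coeffs g \<mu>)"

text \<open>\<open>f(\<^bold>x + y)\<close> is obtained by evaluating \<open>f\<close> at \<open>x\<^sub>0 := y\<close> and \<open>x\<^sub>i\<^sub>+\<^sub>1 := x\<^sub>i\<close>. The sum over the
  exponents \<open>j\<close> of \<open>y\<close> has finitely many nonzero terms if \<open>f\<close> has bounded degree.\<close>

lift_definition add_variable :: "'a::comm_ring_1 mseries \<Rightarrow> 'a \<Rightarrow> 'a mseries" is
  "\<lambda>f y M. Sum_any (\<lambda>j. f (replicate_mset j 0 + image_mset Suc M) * y ^ j)" .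

text \<open>\<open>1 / (1 - f)\<close>, that is \<open>\<Sum>j. f ^ j\<close>, for \<open>f\<close> without constant term; each
  coefficient is then a finite sum.\<close>

definition geometric_series :: "'a::comm_ring_1 mseries \<Rightarrow> 'a mseries" where
  "geometric_series f = Abs_mseries (\<lambda>M. Sum_any (\<lambda>j. mcoeff (f ^ j) M))"

definition path_weight :: "(nat \<times> nat) list \<Rightarrow> 'a::comm_ring_1 mseries" where
  "path_weight ps = (\<Prod>k\<in>#riser_lengths ps. elem_sym k)"

text \<open>\<open>q\<close> is a parameter, so that the same definition serves over \<open>\<rat>[q]\<close> and over \<open>\<rat>[q, y]\<close>.\<close>

definition C_sym :: "nat \<Rightarrow> nat \<Rightarrow> 'a::comm_ring_1 \<Rightarrow> 'a mseries" where
  "C_sym m n q = (\<Sum>ps \<in> {ps \<in> schroeder_paths m n. diag ps = 0}.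
     mconst (q ^ area m n ps) * path_weight ps)"

end

theory Submission
  imports Defs
begin

text \<open>
  Both sides count the same labelled paths, because pairing with \<open>p\<^sub>1\<^sup>a h\<^sub>k\<close> reads off a coefficient.

  The complete homogeneous functions are dual to the monomial functions, and
  \<open>p\<^sub>1\<^sup>a h\<^sub>k\<close> is the product of \<open>h\<^sub>k\<close> and \<open>a\<close> factors \<open>h\<^sub>1\<close>. So its scalar product with a symmetric \<open>f\<close>
  is the coefficient in \<open>f\<close> of the \<open>k\<close>-th power of one variable times \<open>a\<close> other distinct variables
  (\<open>hall_inner_homog_sym\<close>). This instance of the duality follows from
  \<open>h\<^sub>k = \<Sum>\<^sub>\<mu> p\<^sub>\<mu> / z\<^sub>\<mu>\<close> and induction on \<open>a\<close>, since multiplication by \<open>p\<^sub>1\<close> is adjoint to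
  extracting the terms linear in a new variable. The scalar product is defined through expansions
  in power sums; these are unique because the change of basis to monomials is triangular
  (\<open>power_sum_expansion_unique\<close>), and they exist for the functions at hand because \<open>e\<^sub>k\<close> is a
  polynomial in power sums by Newton's identities (\<open>elem_sym_in_power_sum_span\<close>).

  The two forms of the theorem agree (\<open>hall_inner_add_variable\<close>): pairing with
  \<open>1 / (1 - p\<^sub>1)\<close> adds up the coefficients of the squarefree monomials \<open>x\<^sub>0 \<dots> x\<^sub>j\<^sub>-\<^sub>1\<close>, and the
  coefficient of such a monomial in \<open>f(\<^bold>x + y)\<close> is \<open>y\<^sup>k\<close> times the coefficient in \<open>f\<close> of the \<open>k\<close>-th power
  of one variable times \<open>j\<close> others, where \<open>k + j\<close> is the degree of \<open>f\<close>.

  It remains to interpret this coefficient for \<open>f = C\<^sub>m\<^sub>,\<^sub>n\<close>. A coefficient of a product of elementary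
  functions, one for each riser of a path, counts the labelings of the up steps that increase along
  the risers and have prescribed content (\<open>mcoeff_path_weight\<close>). Take the content consisting of
  \<open>k\<close> copies of \<open>n + 1\<close> and of \<open>1, \<dots>, n - k\<close>. The largest label can only stand at the top of a riser,
  and every riser is followed by a right step, because a path ending at \<open>(m, n)\<close> with an up step
  would have left the admissible region one step earlier. Replacing each up step labelled \<open>n + 1\<close>
  and the right step after it by one diagonal step turns the labelled path without diagonal steps
  into a parking function on a path with \<open>k\<close> diagonal steps, and this is a bijection
  (\<open>bij_betw_peaks\<close>). In every row the step going up still starts at the same point, so the area
  does not change (\<open>row_starts_peaks\<close>).
\<close>

section \<open>Coefficients of power sum products\<close>

lemma mcoeff_zero [simp]: "mcoeff 0 M = 0"
  by (simp add: zero_mseries.rep_eq)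

lemma mcoeff_one: "mcoeff 1 M = (if M = {#} then 1 else 0)"
  by (simp add: one_mseries.rep_eq)

lemma mcoeff_add [simp]: "mcoeff (f + g) M = mcoeff f M + mcoeff g M"
  by (simp add: plus_mseries.rep_eq)

lemma mcoeff_sum: "mcoeff (sum f I) M = (\<Sum>i\<in>I. mcoeff (f i) M)"
  by (induction I rule: infinite_finite_induct) auto

lemma mcoeff_mult: "mcoeff (f * g) M = (\<Sum>(A, B)\<in>splits M. mcoeff f A * mcoeff g B)"
  by (simp add: times_mseries.rep_eq)

lemma mcoeff_mconst_mult [simp]: "mcoeff (mconst c * f) M = c * mcoeff f M"
proof -
  have "mcoeff (mconst c * f) M = (\<Sum>p\<in>splits M. if p = ({#}, M) then c * mcoeff f M else 0)"
    unfolding mcoeff_mult mconst.rep_eq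
    by (rule sum.cong) (auto simp: splits_def split: if_splits)
  also have "\<dots> = c * mcoeff f M"
  proof -
    have "({#}, M) \<in> splits M" by (simp add: splits_def)
    then show ?thesis by simp
  qed
  finally show ?thesis .
qed

lemma mconst_mult: "mconst a * mconst b = mconst (a * b)"
  by (rule mseries_eqI) (simp, simp add: mconst.rep_eq)

lemma mconst_one: "mconst 1 = 1"
  by (rule mseries_eqI) (simp add: mconst.rep_eq mcoeff_one)

lemma mcoeff_of_nat_mult [simp]: "mcoeff (of_nat n * f) M = of_nat n * mcoeff f M"
  by (induction n) (auto simp: algebra_simps)

lemma finite_le_count:
  assumes "k > 0"
  shows "finite {i. k \<le> count M i}"
  by (rule finite_subset[of _ "set_mset M"])
     (use assms in \<open>auto simp: Suc_le_eq intro: count_inI\<close>)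

text \<open>Each term of \<open>p\<^sub>k\<close> is the power \<open>x\<^sub>i\<^sup>k\<close> of a single variable, so the
  terms of the product at \<open>M\<close> correspond to the variables from which \<open>k\<close> copies can be removed.
  This recursion replaces explicit formulas for the coefficients of \<open>p\<^sub>\<mu>\<close> throughout.\<close>

lemma mcoeff_power_sum_mult:
  fixes f :: "'a::comm_ring_1 mseries"
  assumes "k > 0"
  shows "mcoeff (power_sum k * f) M = (\<Sum>i | k \<le> count M i. mcoeff f (M - replicate_mset k i))"
proof -
  let ?h = "\<lambda>i. (replicate_mset k i, M - replicate_mset k i)"
  let ?t = "\<lambda>(A, B). mcoeff (power_sum k :: 'a mseries) A * mcoeff f B"
  have inj: "inj_on ?h {i. k \<le> count M i}"
  proof (rule inj_onI)
    fix i j assume "?h i = ?h j"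
    then have "set_mset (replicate_mset k i) = set_mset (replicate_mset k j)" by simp
    then show "i = j" using assms by simp
  qed
  have "mcoeff (power_sum k * f) M = sum ?t (?h ` {i. k \<le> count M i})"
    unfolding mcoeff_mult
  proof (rule sum.mono_neutral_right)
    show "\<forall>p\<in>splits M - ?h ` {i. k \<le> count M i}. ?t p = 0"
    proof
      fix p assume p: "p \<in> splits M - ?h ` {i. k \<le> count M i}"
      obtain A B where AB: "p = (A, B)" "A + B = M" using p by (auto simp: splits_def)
      have "A \<noteq> replicate_mset k i" for i
      proof
        assume "A = replicate_mset k i"
        then have "p = ?h i" "k \<le> count M i" using AB by auto
        then show False using p by blast
      qed
      then show "?t p = 0" by (simp add: AB power_sum.rep_eq)
    qed
  qed (simp, auto simp: splits_def count_le_replicate_mset_subset_eq)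
  also have "\<dots> = (\<Sum>i | k \<le> count M i. mcoeff f (M - replicate_mset k i))"
    unfolding sum.reindex[OF inj] by (rule sum.cong) (auto simp: power_sum.rep_eq)
  finally show ?thesis .
qed

lemma power_sum_mset_empty [simp]: "power_sum_mset {#} = 1"
  by (simp add: power_sum_mset_def)

lemma power_sum_mset_add [simp]: "power_sum_mset (add_mset k \<mu>) = power_sum k * power_sum_mset \<mu>"
  by (simp add: power_sum_mset_def)

lemma power_sum_mset_union: "power_sum_mset (\<mu> + \<nu>) = power_sum_mset \<mu> * power_sum_mset \<nu>"
  by (simp add: power_sum_mset_def)

definition homogeneous :: "nat \<Rightarrow> 'a::comm_ring_1 mseries \<Rightarrow> bool" where
  "homogeneous d f \<longleftrightarrow> (\<forall>M. mcoeff f M \<noteq> 0 \<longrightarrow> size M = d)"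

lemma homogeneousD: "homogeneous d f \<Longrightarrow> size M \<noteq> d \<Longrightarrow> mcoeff f M = 0"
  by (auto simp: homogeneous_def)

lemma homogeneous_power_sum_mset: "homogeneous (sum_mset \<mu>) (power_sum_mset \<mu>)"
proof (induction \<mu>)
  case empty
  then show ?case by (auto simp: homogeneous_def mcoeff_one)
next
  case (add k \<mu>)
  show ?case
    unfolding homogeneous_def power_sum_mset_add
  proof (intro allI impI)
    fix M assume "mcoeff (power_sum k * power_sum_mset \<mu> :: 'a mseries) M \<noteq> 0"
    then obtain A B where "A + B = M" "mcoeff (power_sum k :: 'a mseries) A \<noteq> 0"
        "mcoeff (power_sum_mset \<mu> :: 'a mseries) B \<noteq> 0"
      unfolding mcoeff_mult splits_def by (force elim: sum.not_neutral_contains_not_neutral)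
    with add show "size M = \<Sum>\<^sub># (add_mset k \<mu>)"
      by (auto simp: power_sum.rep_eq homogeneous_def split: if_splits)
  qed
qed

text \<open>A partition of \<open>d\<close> has parts in \<open>{1..d}\<close>, none more than \<open>d\<close> times, so all of them lie
  in one multiset, which has finitely many splittings.\<close>

lemma finite_partitions_of [simp]: "finite (partitions_of d)"
proof -
  let ?U = "\<Sum>i\<le>d. replicate_mset d i"
  have "partitions_of d \<subseteq> fst ` splits ?U"
  proof
    fix \<mu> assume \<mu>: "\<mu> \<in> partitions_of d"
    have le: "i * count \<mu> i \<le> d" for i
    proof -
      have "i * count \<mu> i \<le> sum_mset \<mu>" by (induction \<mu>) auto
      then show ?thesis using \<mu> by (simp add: partitions_of_def)
    qed
    have "\<mu> \<subseteq># ?U"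
    proof (rule mset_subset_eqI)
      fix i
      have "count \<mu> i \<le> (if i \<le> d then d else 0)"
      proof (cases "i = 0")
        case True
        then show ?thesis using \<mu> by (simp add: partitions_of_def not_in_iff)
      next
        case False
        then have "count \<mu> i \<le> d" 
          using le[of i] mult_le_mono1[of 1 i "count \<mu> i"] by linarith
        moreover have "i \<le> d \<or> count \<mu> i = 0"
          using le[of i] mult_le_mono2[of 1 "count \<mu> i" i] by linarith
        ultimately show ?thesis by auto
      qed
      also have "\<dots> = count ?U i"
        by (simp add: count_sum count_replicate_mset)
      finally show "count \<mu> i \<le> count ?U i" .
    qed
    then show "\<mu> \<in> fst ` splits ?U"
      by (force simp: splits_def subset_mset.le_iff_add)
  qed
  then show ?thesis by (rule finite_subset) simp
qed


section \<open>Independence of the power sum products\<close>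

text \<open>The partition \<open>\<lambda>\<close> such that the monomial \<open>M\<close> occurs in the monomial symmetric function
  \<open>m\<^sub>\<lambda>\<close>.\<close>

definition exponents :: "'b multiset \<Rightarrow> nat multiset" where
  "exponents M = image_mset (count M) (mset_set (set_mset M))"

lemma size_exponents: "size (exponents M) = card (set_mset M)"
  by (simp add: exponents_def)

lemma exponents_add_new:
  assumes "i \<notin># M" "k > 0"
  shows "exponents (replicate_mset k i + M) = add_mset k (exponents M)"
proof -
  have "set_mset (replicate_mset k i + M) = insert i (set_mset M)"
    using assms by auto
  moreover have "image_mset (count (replicate_mset k i + M)) (mset_set (set_mset M)) =
      image_mset (count M) (mset_set (set_mset M))"
    by (rule image_mset_cong) (use assms in auto)
  ultimately show ?thesis
    unfolding exponents_def using assms by (simp add: count_eq_zero_iff)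
qed

lemma sum_exponents: "sum_mset (exponents M) = size M"
  by (simp add: exponents_def size_multiset_overloaded_eq sum_unfold_sum_mset)

lemma exists_monomial_with_exponents:
  assumes "0 \<notin># \<mu>"
  shows "\<exists>M :: nat multiset. exponents M = \<mu>"
  using assms
proof (induction \<mu>)
  case empty
  then show ?case by (auto simp: exponents_def intro: exI[of _ "{#}"])
next
  case (add k \<mu>)
  then obtain M :: "nat multiset" where M: "exponents M = \<mu>" by auto
  obtain i :: nat where "i \<notin># M"
    by (meson ex_new_if_finite finite_set_mset infinite_UNIV_nat)
  with M add.prems show ?case
    by (metis exponents_add_new gr0I insertI1 set_mset_add_mset_insert)
qed

lemma exponents_diff:
  assumes "k > 0" "count M i = k"
  shows "exponents M = add_mset k (exponents (M - replicate_mset k i))"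
    and "card (set_mset M) = Suc (card (set_mset (M - replicate_mset k i)))"
proof -
  have "M = replicate_mset k i + (M - replicate_mset k i)"
    using assms by (metis count_le_replicate_mset_subset_eq order_refl subset_mset.add_diff_inverse)
  moreover have "i \<notin># M - replicate_mset k i"
    using assms by (simp add: not_in_iff)
  ultimately show *: "exponents M = add_mset k (exponents (M - replicate_mset k i))"
    using exponents_add_new assms(1) by metis
  show "card (set_mset M) = Suc (card (set_mset (M - replicate_mset k i)))"
    using arg_cong[OF *, of size] by (simp add: size_exponents)
qed

lemma set_mset_diff_replicate:
  assumes "k < count M i"
  shows "set_mset (M - replicate_mset k i) = set_mset M"
proof -
  have "0 < count (M - replicate_mset k i) j \<longleftrightarrow> 0 < count M j" for j
    using assms by (cases "j = i") (auto intro: count_inI)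
  then show ?thesis by (metis (no_types, lifting) count_greater_zero_iff subsetI subset_antisym)
qed

text \<open>This is the triangularity behind the independence of the \<open>p\<^sub>\<nu>\<close>. A monomial of
  \<open>p\<^sub>\<nu>\<close> arises by choosing a variable for each part of \<open>\<nu>\<close>; two parts with the same
  variable merge and cost a variable, so without a loss of variables the exponents are the
  parts themselves.\<close>

lemma power_sum_mset_exponents:
  assumes "mcoeff (power_sum_mset \<nu> :: 'a::comm_ring_1 mseries) M \<noteq> 0" "0 \<notin># \<nu>"
  shows "card (set_mset M) < size \<nu> \<or> exponents M = \<nu>"
  using assms
proof (induction \<nu> arbitrary: M)
  case empty
  then show ?case by (auto simp: mcoeff_one exponents_def split: if_splits)
next
  case (add k \<nu>)
  then have k: "k > 0" by auto
  from add.prems obtain i where i: "k \<le> count M i"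
      "mcoeff (power_sum_mset \<nu> :: 'a mseries) (M - replicate_mset k i) \<noteq> 0"
    unfolding power_sum_mset_add mcoeff_power_sum_mult[OF k]
    by (auto elim: sum.not_neutral_contains_not_neutral)
  from add.IH[OF i(2)] add.prems
  have IH: "card (set_mset (M - replicate_mset k i)) < size \<nu> \<or>
      exponents (M - replicate_mset k i) = \<nu>" by auto
  show ?case
  proof (cases "count M i = k")
    case True
    with exponents_diff[OF k True] IH show ?thesis by auto
  next
    case False
    then have "set_mset (M - replicate_mset k i) = set_mset M"
      using i(1) by (intro set_mset_diff_replicate) simp
    with IH show ?thesis by (auto simp flip: size_exponents) (auto simp: size_exponents)
  qed
qed

text \<open>The coefficients are computed over \<^typ>\<open>int\<close>, where positivity makes sense, and then
  transferred to the ring of coefficients.\<close>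

lemma mcoeff_power_sum_mset_of_int:
  assumes "0 \<notin># \<nu>"
  shows "mcoeff (power_sum_mset \<nu> :: 'a::comm_ring_1 mseries) M =
    of_int (mcoeff (power_sum_mset \<nu>) M)"
  using assms
proof (induction \<nu> arbitrary: M)
  case (add k \<nu>)
  then have "k > 0" by auto
  with add show ?case by (simp add: mcoeff_power_sum_mult)
qed (simp add: mcoeff_one)

lemma mcoeff_power_sum_mset_nonneg:
  assumes "0 \<notin># \<nu>"
  shows "mcoeff (power_sum_mset \<nu>) M \<ge> (0::int)"
  using assms
proof (induction \<nu> arbitrary: M)
  case (add k \<nu>)
  then have "k > 0" by auto
  with add show ?case by (simp add: mcoeff_power_sum_mult sum_nonneg)
qed (simp add: mcoeff_one)

lemma mcoeff_power_sum_mset_pos: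
  assumes "0 \<notin># \<nu>" "exponents M = \<nu>"
  shows "mcoeff (power_sum_mset \<nu>) M > (0::int)"
  using assms
proof (induction \<nu> arbitrary: M)
  case empty
  then show ?case by (simp add: mcoeff_one exponents_def mset_set_empty_iff)
next
  case (add k \<nu>)
  then have k: "k > 0" by auto
  from add.prems(2) obtain i where i: "count M i = k"
    unfolding exponents_def by (metis (no_types, lifting) image_iff set_image_mset union_single_eq_member)
  have "exponents (M - replicate_mset k i) = \<nu>"
    using exponents_diff(1)[OF k i] add.prems(2) by simp
  with add have "mcoeff (power_sum_mset \<nu>) (M - replicate_mset k i) > (0::int)" by auto
  then show ?case
    unfolding power_sum_mset_add mcoeff_power_sum_mult[OF k]
    using i k add.prems
    by (intro sum_pos2[of _ i]) (auto intro: finite_le_count mcoeff_power_sum_mset_nonneg)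
qed

text \<open>Among the \<open>\<mu>\<close> of one degree at which the two expansions differ, one with the most parts
  is chosen. At a monomial with exponents \<open>\<mu>\<close>, triangularity kills every other term of the
  difference.\<close>

lemma power_sum_expansion_unique:
  fixes f :: "'a::{idom, ring_char_0} mseries"
  assumes c: "power_sum_expansion f c" and c': "power_sum_expansion f c'"
  shows "c = c'"
proof (rule ccontr)
  assume "c \<noteq> c'"
  define d where "d \<mu> = c \<mu> - c' \<mu>" for \<mu>
  from \<open>c \<noteq> c'\<close> obtain \<mu>0 where \<mu>0: "d \<mu>0 \<noteq> 0" by (auto simp: d_def)
  have d0: "0 \<in># \<mu> \<Longrightarrow> d \<mu> = 0" for \<mu>
    using c c' by (auto simp: power_sum_expansion_def d_def)
  have rel: "(\<Sum>\<mu>\<in>partitions_of (size M). d \<mu> * mcoeff (power_sum_mset \<mu>) M) = 0" for M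
    using c c' by (simp add: power_sum_expansion_def d_def left_diff_distrib sum_subtractf)
  define S where "S = {\<nu> \<in> partitions_of (sum_mset \<mu>0). d \<nu> \<noteq> 0}"
  have "finite S" "\<mu>0 \<in> S"
    using \<mu>0 d0[of \<mu>0] unfolding S_def
    by (simp, auto simp: partitions_of_def)
  then have "Max (size ` S) \<in> size ` S" "\<And>\<nu>. \<nu> \<in> S \<Longrightarrow> size \<nu> \<le> Max (size ` S)"
    by (auto intro!: Max_in)
  then obtain \<mu> where \<mu>: "\<mu> \<in> S" and max: "\<And>\<nu>. \<nu> \<in> S \<Longrightarrow> size \<nu> \<le> size \<mu>"
    by auto
  from \<mu> have \<mu>0': "0 \<notin># \<mu>" and sum: "sum_mset \<mu> = sum_mset \<mu>0"
    by (auto simp: S_def partitions_of_def)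
  from exists_monomial_with_exponents[OF \<mu>0'] obtain M :: "nat multiset" where M: "exponents M = \<mu>"
    by blast
  have size: "size M = sum_mset \<mu>0"
    using M sum sum_exponents[of M] by simp
  have "0 = (\<Sum>\<nu>\<in>partitions_of (size M). d \<nu> * mcoeff (power_sum_mset \<nu>) M)"
    by (simp add: rel)
  also have "\<dots> = (\<Sum>\<nu>\<in>{\<mu>}. d \<nu> * mcoeff (power_sum_mset \<nu>) M)"
  proof (rule sum.mono_neutral_right)
    show "\<forall>\<nu>\<in>partitions_of (size M) - {\<mu>}. d \<nu> * mcoeff (power_sum_mset \<nu>) M = 0"
    proof
      fix \<nu> assume \<nu>: "\<nu> \<in> partitions_of (size M) - {\<mu>}"
      then have "0 \<notin># \<nu>" by (simp add: partitions_of_def)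
      show "d \<nu> * mcoeff (power_sum_mset \<nu>) M = 0"
      proof (rule ccontr)
        assume nz: "d \<nu> * mcoeff (power_sum_mset \<nu>) M \<noteq> 0"
        then have "\<nu> \<in> S" using \<nu> size by (auto simp: S_def)
        from max[OF this] M have "size \<nu> \<le> card (set_mset M)" by (auto simp flip: size_exponents)
        with power_sum_mset_exponents[of \<nu> M, OF _ \<open>0 \<notin># \<nu>\<close>] nz M \<nu> show False by auto
      qed
    qed
  qed (use \<mu> size in \<open>auto simp: S_def\<close>)
  finally have "d \<mu> * of_int (mcoeff (power_sum_mset \<mu>) M) = 0"
    using mcoeff_power_sum_mset_of_int[OF \<mu>0', of M, where 'a = 'a] by simp
  with mcoeff_power_sum_mset_pos[OF \<mu>0' M] \<mu> show False
    by (simp add: S_def)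
qed

lemma power_sum_coeffs_eqI:
  fixes f :: "'a::{idom, ring_char_0} mseries"
  assumes "power_sum_expansion f c"
  shows "power_sum_coeffs f = c"
  unfolding power_sum_coeffs_def using assms power_sum_expansion_unique by blast


section \<open>The span of the power sum products\<close>

text \<open>Domains that contain the rational numbers, as needed to divide by \<open>k\<close> in Newton's
  identities and by \<open>z\<^sub>\<mu>\<close>. Divisibility of \<open>1\<close> is a formulation that passes to polynomial
  rings, hence to \<open>\<rat>[q]\<close> and to \<open>\<rat>[q, y]\<close>.\<close>

class rational_domain = idom + ring_char_0 +
  assumes of_nat_dvd_one: "n > 0 \<Longrightarrow> of_nat n dvd 1"

instance rat :: rational_domain
proof
  fix n :: nat
  assume "n > 0"
  then have "1 = of_nat n * (1 / of_nat n :: rat)" by simp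
  then show "of_nat n dvd (1 :: rat)" by (rule dvdI)
qed

instance poly :: (rational_domain) rational_domain
proof
  fix n :: nat
  assume "n > 0"
  then have "(of_nat n :: 'a) dvd 1" by (rule of_nat_dvd_one)
  then obtain u :: 'a where "1 = of_nat n * u" by (rule dvdE)
  then have "[:1:] = [:of_nat n * u:]" by (rule arg_cong)
  then have "1 = of_nat n * [:u:]"
    by (simp only: of_nat_poly one_pCons mult_pCons_left smult_pCons smult_0_right mult_zero_left
      pCons_0_0 add_0_right)
  then show "of_nat n dvd (1 :: 'a poly)" by (rule dvdI)
qed

text \<open>The finite linear combinations of the \<open>p\<^sub>\<mu>\<close>. Members have a power sum expansion,
  and the set is closed under products by induction on the two combinations.\<close>

inductive_set power_sum_span :: "'a::comm_ring_1 mseries set" where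
  zero: "0 \<in> power_sum_span"
| add_term: "f \<in> power_sum_span \<Longrightarrow> 0 \<notin># \<mu> \<Longrightarrow> mconst c * power_sum_mset \<mu> + f \<in> power_sum_span"

lemma power_sum_expansion_power_sum_mset:
  assumes "0 \<notin># \<mu>"
  shows "power_sum_expansion (power_sum_mset \<mu>) (\<lambda>\<nu>. if \<nu> = \<mu> then 1 else 0)"
  unfolding power_sum_expansion_def
proof (intro conjI allI)
  fix M
  have "(\<Sum>\<nu>\<in>partitions_of (size M). (if \<nu> = \<mu> then 1 else 0) * mcoeff (power_sum_mset \<nu>) M)
      = (\<Sum>\<nu>\<in>partitions_of (size M). if \<nu> = \<mu> then mcoeff (power_sum_mset \<mu>) M else (0::'a))"
    by (rule sum.cong) auto
  also have "\<dots> = mcoeff (power_sum_mset \<mu>) M"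
    using assms homogeneousD[OF homogeneous_power_sum_mset, of M \<mu>]
    by (subst sum.delta) (simp, auto simp: partitions_of_def)
  finally show "mcoeff (power_sum_mset \<mu> :: 'a mseries) M =
      (\<Sum>\<nu>\<in>partitions_of (size M). (if \<nu> = \<mu> then 1 else 0) * mcoeff (power_sum_mset \<nu>) M)" ..
qed (use assms in auto)

lemma power_sum_expansion_lincomb:
  assumes "power_sum_expansion f c" "power_sum_expansion g c'"
  shows "power_sum_expansion (mconst a * f + g) (\<lambda>\<mu>. a * c \<mu> + c' \<mu>)"
  using assms
  by (auto simp: power_sum_expansion_def sum_distrib_left sum.distrib distrib_right mult.assoc)

lemma power_sum_span_expansion:
  assumes "f \<in> power_sum_span"
  shows "\<exists>c. power_sum_expansion f c"
  using assms
proof induction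
  case zero
  have "power_sum_expansion (0 :: 'a mseries) (\<lambda>_. 0)" by (simp add: power_sum_expansion_def)
  then show ?case by blast
next
  case (add_term f \<mu> c)
  then show ?case using power_sum_expansion_lincomb power_sum_expansion_power_sum_mset by blast
qed

lemma power_sum_span_power_sum_mset:
  assumes "0 \<notin># \<mu>"
  shows "power_sum_mset \<mu> \<in> power_sum_span"
  using power_sum_span.add_term[OF power_sum_span.zero assms, of 1] by (simp add: mconst_one)

lemma power_sum_span_one: "1 \<in> power_sum_span"
  using power_sum_span_power_sum_mset[of "{#}"] by simp

lemma power_sum_span_power_sum: "k > 0 \<Longrightarrow> power_sum k \<in> power_sum_span"
  using power_sum_span_power_sum_mset[of "{#k#}"] by simp

lemma power_sum_span_add:
  assumes "f \<in> power_sum_span" "g \<in> power_sum_span"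
  shows "f + g \<in> power_sum_span"
  using assms(1) by induction (simp_all add: assms(2) add.assoc power_sum_span.add_term)

lemma power_sum_span_mconst_mult:
  assumes "f \<in> power_sum_span"
  shows "mconst c * f \<in> power_sum_span"
  using assms
proof induction
  case (add_term f \<mu> a)
  have "mconst c * (mconst a * power_sum_mset \<mu> + f) = mconst (c * a) * power_sum_mset \<mu> + mconst c * f"
    by (simp only: distrib_left mconst_mult mult.assoc[symmetric])
  then show ?case using add_term power_sum_span.add_term by metis
qed (simp add: power_sum_span.zero)

lemma power_sum_span_mult:
  assumes "f \<in> power_sum_span" "g \<in> power_sum_span"
  shows "f * g \<in> power_sum_span"
proof -
  have *: "power_sum_mset \<mu> * g \<in> power_sum_span" if "0 \<notin># \<mu>" for \<mu>
    using assms(2)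
  proof induction
    case (add_term g \<nu> a)
    have "power_sum_mset \<mu> * (mconst a * power_sum_mset \<nu> + g) =
        mconst a * power_sum_mset (\<mu> + \<nu>) + power_sum_mset \<mu> * g"
      by (simp add: power_sum_mset_union distrib_left mult.left_commute)
    moreover have "0 \<notin># \<mu> + \<nu>" using add_term that by simp
    ultimately show ?case using add_term.IH power_sum_span.add_term by metis
  qed (simp add: power_sum_span.zero)
  show ?thesis
    using assms(1)
  proof induction
    case (add_term f \<mu> a)
    have "(mconst a * power_sum_mset \<mu> + f) * g = mconst a * (power_sum_mset \<mu> * g) + f * g"
      by (simp only: distrib_right mult.assoc)
    then show ?case
      using add_term * power_sum_span_add power_sum_span_mconst_mult by metis
  qed (simp add: power_sum_span.zero)
qed

lemma power_sum_span_sum: "(\<And>i. i \<in> I \<Longrightarrow> f i \<in> power_sum_span) \<Longrightarrow> sum f I \<in> power_sum_span"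
  by (induction I rule: infinite_finite_induct) (auto intro: power_sum_span.zero power_sum_span_add)

section \<open>Newton identities\<close>

text \<open>At most two consecutive values of \<open>i\<close> contribute, with opposite signs; for \<open>c = 1\<close> the
  value \<open>i = 0\<close> is out of range and the term for \<open>i = 1\<close> stays alone.\<close>

lemma alternating_indicator_sum:
  assumes "0 < c" "c \<le> k"
  shows "(\<Sum>i = 1..k. (- 1) ^ (i - 1) * (if i \<le> c \<and> c \<le> Suc i then 1 else 0)) =
    (if c = 1 then 1 else (0 :: 'a::comm_ring_1))"
proof -
  have "(\<Sum>i = 1..k. (- 1) ^ (i - 1) * (if i \<le> c \<and> c \<le> Suc i then 1 else 0)) =
      (\<Sum>i\<in>{c - 1, c} - {0}. (- 1) ^ (i - 1) :: 'a)"
    by (rule sum.mono_neutral_cong_right) (use assms in \<open>auto split: if_splits\<close>)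
  also have "\<dots> = (if c = 1 then 1 else 0)"
  proof (cases "c = 1")
    case False
    then obtain d where "c = Suc (Suc d)"
      using assms by (metis One_nat_def not0_implies_Suc not_gr_zero)
    then show ?thesis by (simp add: insert_Diff_if)
  qed (simp add: insert_Diff_if)
  finally show ?thesis .
qed

lemma size_eq_card_if_squarefree:
  assumes "\<forall>i. count M i \<le> 1"
  shows "card (set_mset M) = size M"
proof -
  have "size M = (\<Sum>i\<in>set_mset M. 1)"
    unfolding size_multiset_overloaded_eq
  proof (rule sum.cong)
    fix i assume "i \<in># M"
    then have "0 < count M i" by simp
    with assms[rule_format, of i] show "count M i = 1" by linarith
  qed simp
  then show ?thesis by simp
qed

text \<open>A monomial in \<open>p\<^sub>i e\<^sub>k\<^sub>-\<^sub>i\<close> is squarefree except for one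
  variable \<open>x\<^sub>j\<close>, whose exponent is \<open>i\<close> or \<open>i + 1\<close> according to whether \<open>x\<^sub>j\<close> also
  occurs in the second factor. For fixed \<open>j\<close> the alternating sum telescopes and only the case
  of exponent \<open>1\<close> survives, which gives each squarefree monomial once for every variable in it.\<close>

lemma newton_elem_sym:
  "of_nat k * elem_sym k =
    (\<Sum>i = 1..k. mconst ((- 1) ^ (i - 1)) * (power_sum i * elem_sym (k - i)) :: 'a::comm_ring_1 mseries)"
proof (rule mseries_eqI)
  fix M :: "nat multiset"
  \<comment> \<open>the variables other than \<open>j\<close> occur at most once\<close>
  define others where "others j \<longleftrightarrow> (\<forall>t. t \<noteq> j \<longrightarrow> count M t \<le> 1)" for j
  have coeff: "mcoeff (power_sum i * elem_sym (k - i) :: 'a mseries) M =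
      (\<Sum>j\<in>set_mset M. if size M = k \<and> others j then if i \<le> count M j \<and> count M j \<le> Suc i then 1 else 0 else 0)"
    if i: "i \<in> {1..k}" for i
  proof -
    have "mcoeff (power_sum i * elem_sym (k - i) :: 'a mseries) M =
        (\<Sum>j | i \<le> count M j. mcoeff (elem_sym (k - i)) (M - replicate_mset i j))"
      using i by (intro mcoeff_power_sum_mult) auto
    also have "\<dots> =
      (\<Sum>j\<in>set_mset M. if size M = k \<and> others j then if i \<le> count M j \<and> count M j \<le> Suc i then 1 else 0 else 0)"
    proof (rule sum.mono_neutral_cong_left)
      show "{j. i \<le> count M j} \<subseteq> set_mset M" using i by (auto intro: count_inI)
    next
      fix j assume "j \<in> {j. i \<le> count M j}"
      then have le: "i \<le> count M j" by simp
      then have "size (M - replicate_mset i j) = size M - i"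
        by (simp add: size_Diff_submset count_le_replicate_mset_subset_eq)
      moreover have "i \<le> size M"
        using le count_le_size[of M j] by linarith
      moreover have "(\<forall>t. count (M - replicate_mset i j) t \<le> 1) \<longleftrightarrow> others j \<and> count M j \<le> Suc i"
        unfolding others_def using le by (auto split: if_splits)
      ultimately show "mcoeff (elem_sym (k - i) :: 'a mseries) (M - replicate_mset i j) =
          (if size M = k \<and> others j then if i \<le> count M j \<and> count M j \<le> Suc i then 1 else 0 else 0)"
        using i le by (auto simp: elem_sym.rep_eq)
    qed auto
    finally show ?thesis .
  qed
  have "mcoeff (\<Sum>i = 1..k. mconst ((- 1) ^ (i - 1)) * (power_sum i * elem_sym (k - i)) :: 'a mseries) M =
      (\<Sum>i = 1..k. (- 1) ^ (i - 1) * (\<Sum>j\<in>set_mset M.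
        if size M = k \<and> others j then if i \<le> count M j \<and> count M j \<le> Suc i then 1 else 0 else 0))"
    unfolding mcoeff_sum mcoeff_mconst_mult by (rule sum.cong) (simp_all only: coeff)
  also have "\<dots> = (\<Sum>j\<in>set_mset M. if size M = k \<and> others j then
      (\<Sum>i = 1..k. (- 1) ^ (i - 1) * (if i \<le> count M j \<and> count M j \<le> Suc i then 1 else 0)) else 0)"
    unfolding sum_distrib_left by (subst sum.swap) (auto intro!: sum.cong)
  also have "\<dots> = (\<Sum>j\<in>set_mset M. if size M = k \<and> others j \<and> count M j = 1 then 1 else 0)"
  proof (rule sum.cong)
    fix j assume "j \<in># M"
    then have "0 < count M j" by simp
    then show "(if size M = k \<and> others j then
      (\<Sum>i = 1..k. (- 1) ^ (i - 1) * (if i \<le> count M j \<and> count M j \<le> Suc i then 1 else 0)) else 0) =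
      (if size M = k \<and> others j \<and> count M j = 1 then 1 else (0::'a))"
      using alternating_indicator_sum[of "count M j" k, where 'a = 'a] count_le_size[of M j] by auto
  qed simp
  also have "\<dots> = (\<Sum>j\<in>set_mset M. if size M = k \<and> (\<forall>t. count M t \<le> 1) then 1 else 0)"
  proof (rule sum.cong)
    fix j assume "j \<in># M"
    then have "0 < count M j" by simp
    then have "others j \<and> count M j = 1 \<longleftrightarrow> (\<forall>t. count M t \<le> 1)"
      unfolding others_def by (metis One_nat_def Suc_leI le_antisym order_refl)
    then show "(if size M = k \<and> others j \<and> count M j = 1 then 1 else 0) =
        (if size M = k \<and> (\<forall>t. count M t \<le> 1) then 1 else (0::'a))" by simp
  qed simp
  also have "\<dots> = mcoeff (of_nat k * elem_sym k) M"
    using size_eq_card_if_squarefree[of M] by (auto simp: elem_sym.rep_eq)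
  finally show "mcoeff (of_nat k * elem_sym k) M =
      mcoeff (\<Sum>i = 1..k. mconst ((- 1) ^ (i - 1)) * (power_sum i * elem_sym (k - i)) :: 'a mseries) M" ..
qed

lemma elem_sym_0: "elem_sym 0 = 1"
  by (rule mseries_eqI) (auto simp: elem_sym.rep_eq mcoeff_one)

lemma homog_sym_0: "homog_sym 0 = 1"
  by (rule mseries_eqI) (auto simp: homog_sym.rep_eq mcoeff_one)

lemma elem_sym_in_power_sum_span: "(elem_sym k :: 'a::rational_domain mseries) \<in> power_sum_span"
proof (induction k rule: less_induct)
  case (less k)
  show ?case
  proof (cases "k = 0")
    case True
    then show ?thesis by (simp add: elem_sym_0 power_sum_span_one)
  next
    case False
    then have "(of_nat k :: 'a) dvd 1" by (intro of_nat_dvd_one) simp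
    then obtain u :: 'a where u: "1 = of_nat k * u" by (rule dvdE)
    have "elem_sym k = mconst u * (of_nat k * elem_sym k)"
    proof (rule mseries_eqI)
      fix M
      show "mcoeff (elem_sym k) M = mcoeff (mconst u * (of_nat k * elem_sym k)) M"
        unfolding mcoeff_mconst_mult mcoeff_of_nat_mult
        using arg_cong[OF u, of "\<lambda>t. t * mcoeff (elem_sym k) M"] by (simp add: ac_simps)
    qed
    moreover have "of_nat k * elem_sym k \<in> (power_sum_span :: 'a mseries set)"
      unfolding newton_elem_sym
    proof (rule power_sum_span_sum, rule power_sum_span_mconst_mult, rule power_sum_span_mult)
      fix i assume i: "i \<in> {1..k}"
      then show "(power_sum i :: 'a mseries) \<in> power_sum_span" by (intro power_sum_span_power_sum) simp
      show "(elem_sym (k - i) :: 'a mseries) \<in> power_sum_span" using i False by (intro less.IH) simp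
    qed
    ultimately show ?thesis using power_sum_span_mconst_mult by metis
  qed
qed

lemma sum_counts_eq_mcoeff_homog_sym:
  "(\<Sum>j\<in>set_mset M. if size M = k then of_nat (count M j) else 0) =
    mcoeff (of_nat k * homog_sym k :: 'a::comm_ring_1 mseries) M"
proof -
  have "(\<Sum>j\<in>set_mset M. of_nat (count M j)) = (of_nat (size M) :: 'a)"
    by (subst size_multiset_overloaded_eq) (rule of_nat_sum[symmetric])
  then show ?thesis
    by (cases "size M = k")
       (simp_all only: refl if_True if_False homog_sym.rep_eq mcoeff_of_nat_mult mult_1_right
          mult_zero_right sum.neutral_const)
qed

text \<open>The monomial \<open>M\<close> occurs in \<open>p\<^sub>i h\<^sub>k\<^sub>-\<^sub>i\<close> once for every variable
  of exponent at least \<open>i\<close>, and summing over \<open>i\<close> counts every variable with its exponent.\<close>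

lemma newton_homog_sym:
  "of_nat k * homog_sym k = (\<Sum>i = 1..k. power_sum i * homog_sym (k - i) :: 'a::comm_ring_1 mseries)"
proof (rule mseries_eqI)
  fix M :: "nat multiset"
  have coeff: "mcoeff (power_sum i * homog_sym (k - i) :: 'a mseries) M =
      (\<Sum>j\<in>set_mset M. if size M = k \<and> i \<le> count M j then 1 else 0)"
    if i: "i \<in> {1..k}" for i
  proof -
    have "mcoeff (power_sum i * homog_sym (k - i) :: 'a mseries) M =
        (\<Sum>j | i \<le> count M j. mcoeff (homog_sym (k - i)) (M - replicate_mset i j))"
      using i by (intro mcoeff_power_sum_mult) auto
    also have "\<dots> = (\<Sum>j\<in>set_mset M. if size M = k \<and> i \<le> count M j then 1 else 0)"
    proof (rule sum.mono_neutral_cong_left)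
      show "{j. i \<le> count M j} \<subseteq> set_mset M" using i by (auto intro: count_inI)
    next
      fix j assume "j \<in> {j. i \<le> count M j}"
      then have le: "i \<le> count M j" by simp
      then have "size (M - replicate_mset i j) = size M - i"
        by (simp add: size_Diff_submset count_le_replicate_mset_subset_eq)
      moreover have "i \<le> size M"
        using le count_le_size[of M j] by linarith
      ultimately show "mcoeff (homog_sym (k - i) :: 'a mseries) (M - replicate_mset i j) =
          (if size M = k \<and> i \<le> count M j then 1 else 0)"
        using i le unfolding homog_sym.rep_eq by (intro if_cong) auto
    qed auto
    finally show ?thesis .
  qed
  have "mcoeff (\<Sum>i = 1..k. power_sum i * homog_sym (k - i) :: 'a mseries) M =
      (\<Sum>i = 1..k. \<Sum>j\<in>set_mset M. if size M = k \<and> i \<le> count M j then 1 else 0)"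
    unfolding mcoeff_sum by (rule sum.cong) (simp_all only: coeff)
  also have "\<dots> = (\<Sum>j\<in>set_mset M. \<Sum>i = 1..k. if size M = k \<and> i \<le> count M j then 1 else 0)"
    by (rule sum.swap)
  also have "\<dots> = (\<Sum>j\<in>set_mset M. if size M = k then of_nat (count M j) else 0)"
  proof (rule sum.cong)
    fix j
    have "(\<Sum>i = 1..k. if i \<le> count M j then 1 else (0::'a)) = of_nat (count M j)" if "size M = k"
    proof -
      have "(\<Sum>i = 1..k. if i \<le> count M j then 1 else (0::'a)) = (\<Sum>i = 1..count M j. 1)"
        by (rule sum.mono_neutral_cong_right) (use count_le_size[of M j] that in auto)
      then show ?thesis by simp
    qed
    then show "(\<Sum>i = 1..k. if size M = k \<and> i \<le> count M j then 1 else 0) =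
        (if size M = k then of_nat (count M j) else (0::'a))"
      by (cases "size M = k") (simp_all only: simp_thms if_True if_False sum.neutral_const)
  qed simp
  also have "\<dots> = mcoeff (of_nat k * homog_sym k) M"
    by (rule sum_counts_eq_mcoeff_homog_sym)
  finally show "mcoeff (of_nat k * homog_sym k) M =
      mcoeff (\<Sum>i = 1..k. power_sum i * homog_sym (k - i) :: 'a mseries) M" ..
qed


section \<open>The scalar product as a coefficient\<close>

lemma zfactor_add_mset:
  "zfactor (add_mset i \<mu>) = i * Suc (count \<mu> i) * zfactor \<mu>"
proof -
  let ?z = "\<lambda>\<nu> j. j ^ count \<nu> j * fact (count \<nu> j) :: nat"
  have z: "zfactor \<nu> = prod (?z \<nu>) (insert i (set_mset \<mu>))"
    if "set_mset \<nu> \<subseteq> insert i (set_mset \<mu>)" for \<nu>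
    unfolding zfactor_def
    by (rule prod.mono_neutral_left) (use that in \<open>auto simp: not_in_iff\<close>)
  have "zfactor (add_mset i \<mu>) = ?z (add_mset i \<mu>) i * prod (?z (add_mset i \<mu>)) (set_mset \<mu> - {i})"
    by (subst z) (simp_all add: prod.insert_remove)
  also have "prod (?z (add_mset i \<mu>)) (set_mset \<mu> - {i}) = prod (?z \<mu>) (set_mset \<mu> - {i})"
    by (rule prod.cong) auto
  finally have "zfactor (add_mset i \<mu>) = i * Suc (count \<mu> i) * (?z \<mu> i * prod (?z \<mu>) (set_mset \<mu> - {i}))"
    by (simp add: algebra_simps)
  also have "?z \<mu> i * prod (?z \<mu>) (set_mset \<mu> - {i}) = zfactor \<mu>"
    by (subst z) (auto simp: prod.insert_remove)
  finally show ?thesis .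
qed

lemma zfactor_pos: "0 \<notin># \<mu> \<Longrightarrow> zfactor \<mu> > 0"
  by (induction \<mu>) (simp_all add: zfactor_add_mset zfactor_def)

lemma sum_mset_eq_sum_count: "sum_mset \<mu> = (\<Sum>i\<in>set_mset \<mu>. i * count \<mu> i)" for \<mu> :: "nat multiset"
proof (induction \<mu>)
  case (add i \<mu>)
  have "(\<Sum>j\<in>set_mset (add_mset i \<mu>). j * count (add_mset i \<mu>) j) =
      (\<Sum>j\<in>insert i (set_mset \<mu>). j * count \<mu> j + (if j = i then i else 0))"
    by (rule sum.cong) auto
  also have "\<dots> = (\<Sum>j\<in>insert i (set_mset \<mu>). j * count \<mu> j) + i"
    by (simp add: sum.distrib)
  also have "(\<Sum>j\<in>insert i (set_mset \<mu>). j * count \<mu> j) = (\<Sum>j\<in>set_mset \<mu>. j * count \<mu> j)"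
    by (rule sum.mono_neutral_right) (auto simp: not_in_iff)
  finally show ?case using add by simp
qed simp

text \<open>Here \<open>w \<mu>\<close> is \<open>1 / z\<^sub>\<mu>\<close>. The identity holds after multiplication by \<open>k\<close>: on the
  right, \<open>k\<close> is written as the sum of the parts \<open>i\<close> of \<open>\<mu>\<close> with their multiplicities, and each
  such \<open>i\<close> times its multiplicity cancels the factor by which \<open>z\<^sub>\<mu>\<close> exceeds the \<open>z\<close> of
  \<open>\<mu>\<close> without \<open>i\<close>. What remains is Newton's identity.\<close>

lemma homog_sym_power_sums:
  fixes w :: "nat multiset \<Rightarrow> 'a::{idom, ring_char_0}"
  assumes w: "\<And>\<mu>. 0 \<notin># \<mu> \<Longrightarrow> of_nat (zfactor \<mu>) * w \<mu> = 1"
  shows "homog_sym k = (\<Sum>\<mu>\<in>partitions_of k. mconst (w \<mu>) * power_sum_mset \<mu>)"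
proof (induction k rule: less_induct)
  case (less k)
  show ?case
  proof (cases "k = 0")
    case True
    have "partitions_of 0 = {{#}}"
      unfolding partitions_of_def by (auto simp: sum_mset_0_iff) (metis multiset_nonemptyE)
    with True w[of "{#}"] show ?thesis by (simp add: homog_sym_0 zfactor_def mconst_one)
  next
    case False
    have step: "of_nat (i * count \<mu> i) * w \<mu> = w (\<mu> - {#i#})" if "\<mu> \<in> partitions_of k" "i \<in># \<mu>" for i \<mu>
    proof -
      from that(2) obtain \<nu> where \<nu>: "\<mu> = add_mset i \<nu>" by (meson mset_add)
      have \<nu>0: "0 \<notin># \<mu>" "0 \<notin># \<nu>" using that(1) \<nu> by (auto simp: partitions_of_def)
      have "of_nat (zfactor \<nu>) * (of_nat (i * count \<mu> i) * w \<mu>) = of_nat (zfactor \<mu>) * w \<mu>"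
        by (simp add: \<nu> zfactor_add_mset algebra_simps)
      also have "\<dots> = of_nat (zfactor \<nu>) * w \<nu>" using \<nu>0 w by simp
      finally show ?thesis using zfactor_pos[OF \<nu>0(2)] \<nu> by simp
    qed
    have "of_nat k * homog_sym k = (\<Sum>i = 1..k. power_sum i * homog_sym (k - i) :: 'a mseries)"
      by (rule newton_homog_sym)
    also have "\<dots> = (\<Sum>i = 1..k. \<Sum>\<nu>\<in>partitions_of (k - i). mconst (w \<nu>) * power_sum_mset (add_mset i \<nu>))"
    proof (rule sum.cong)
      fix i assume "i \<in> {1..k}"
      then have "k - i < k" using False by auto
      then show "power_sum i * homog_sym (k - i) =
          (\<Sum>\<nu>\<in>partitions_of (k - i). mconst (w \<nu>) * power_sum_mset (add_mset i \<nu>))"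
        by (simp add: less sum_distrib_left mult.left_commute)
    qed simp
    also have "\<dots> = (\<Sum>(i, \<nu>)\<in>(SIGMA i:{1..k}. partitions_of (k - i)).
        mconst (w \<nu>) * power_sum_mset (add_mset i \<nu>))"
      by (rule sum.Sigma) auto
    also have "\<dots> = (\<Sum>(\<mu>, i)\<in>(SIGMA \<mu>:partitions_of k. set_mset \<mu>).
        mconst (w (\<mu> - {#i#})) * power_sum_mset \<mu>)"
    proof (rule sum.reindex_bij_witness[where i = "\<lambda>(\<mu>, i). (i, \<mu> - {#i#})" and j = "\<lambda>(i, \<nu>). (add_mset i \<nu>, i)"])
      fix p assume "p \<in> (SIGMA \<mu>:partitions_of k. set_mset \<mu>)"
      then obtain \<mu> i where p: "p = (\<mu>, i)" "\<mu> \<in> partitions_of k" "i \<in># \<mu>" by auto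
      from p(3) obtain \<nu> where \<nu>: "\<mu> = add_mset i \<nu>" by (meson mset_add)
      show "(case p of (\<mu>, i) \<Rightarrow> (i, \<mu> - {#i#})) \<in> (SIGMA i:{1..k}. partitions_of (k - i))"
        using p \<nu> by (auto simp: partitions_of_def Suc_le_eq)
    qed (auto simp: partitions_of_def)
    also have "\<dots> = (\<Sum>\<mu>\<in>partitions_of k. \<Sum>i\<in>set_mset \<mu>. mconst (w (\<mu> - {#i#})) * power_sum_mset \<mu>)"
      by (rule sum.Sigma[symmetric]) auto
    also have "\<dots> = (\<Sum>\<mu>\<in>partitions_of k. of_nat k * (mconst (w \<mu>) * power_sum_mset \<mu>))"
    proof (rule sum.cong)
      fix \<mu> assume \<mu>: "\<mu> \<in> partitions_of k"
      have "(\<Sum>i\<in>set_mset \<mu>. i * count \<mu> i) = k"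
        using \<mu> by (simp add: partitions_of_def sum_mset_eq_sum_count)
      then have "of_nat k * w \<mu> = (\<Sum>i\<in>set_mset \<mu>. of_nat (i * count \<mu> i) * w \<mu>)"
        by (metis of_nat_sum sum_distrib_right)
      also have "\<dots> = (\<Sum>i\<in>set_mset \<mu>. w (\<mu> - {#i#}))"
        using step[OF \<mu>] by (intro sum.cong) auto
      finally have k: "of_nat k * w \<mu> = (\<Sum>i\<in>set_mset \<mu>. w (\<mu> - {#i#}))" .
      show "(\<Sum>i\<in>set_mset \<mu>. mconst (w (\<mu> - {#i#})) * power_sum_mset \<mu>) =
          of_nat k * (mconst (w \<mu>) * power_sum_mset \<mu>)"
        by (rule mseries_eqI) (simp add: mcoeff_sum, simp add: k flip: sum_distrib_right mult.assoc)
    qed simp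
    also have "\<dots> = of_nat k * (\<Sum>\<mu>\<in>partitions_of k. mconst (w \<mu>) * power_sum_mset \<mu>)"
      by (simp add: sum_distrib_left)
    finally have eq: "of_nat k * homog_sym k =
        of_nat k * (\<Sum>\<mu>\<in>partitions_of k. mconst (w \<mu>) * power_sum_mset \<mu>)" .
    show ?thesis
    proof (rule mseries_eqI)
      fix M
      show "mcoeff (homog_sym k) M = mcoeff (\<Sum>\<mu>\<in>partitions_of k. mconst (w \<mu>) * power_sum_mset \<mu>) M"
        using arg_cong[OF eq, of "\<lambda>f. mcoeff f M"] False by simp
    qed
  qed
qed

text \<open>A variable of exponent one can only come from a factor \<open>p\<^sub>1\<close>, so extracting the
  terms linear in a new variable acts on power sums as the derivative with respect to
  \<open>p\<^sub>1\<close>.\<close>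

lemma mcoeff_power_sum_mset_add_new:
  assumes "0 \<notin># \<mu>" "j \<notin># M"
  shows "mcoeff (power_sum_mset \<mu> :: 'a::comm_ring_1 mseries) (add_mset j M) =
    of_nat (count \<mu> 1) * mcoeff (power_sum_mset (\<mu> - {#1#})) M"
  using assms
proof (induction \<mu> arbitrary: M)
  case empty
  then show ?case by (simp add: mcoeff_one)
next
  case (add k \<mu>)
  have k: "k > 0" and \<mu>: "0 \<notin># \<mu>" using add.prems by auto
  let ?p = "\<lambda>\<mu>. power_sum_mset \<mu> :: 'a mseries"
  have j: "count M j = 0" using add.prems by (simp add: not_in_iff)
  have fin: "finite {i. k \<le> count M i}" using k by (rule finite_le_count)
  have idx: "{i. k \<le> count (add_mset j M) i} = (if k = 1 then {j} else {}) \<union> {i. k \<le> count M i}"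
    using k j by auto
  have "mcoeff (?p (add_mset k \<mu>)) (add_mset j M) =
      (\<Sum>i | k \<le> count (add_mset j M) i. mcoeff (?p \<mu>) (add_mset j M - replicate_mset k i))"
    by (simp only: power_sum_mset_add mcoeff_power_sum_mult[OF k])
  also have "\<dots> = (if k = 1 then mcoeff (?p \<mu>) M else 0) +
      (\<Sum>i | k \<le> count M i. mcoeff (?p \<mu>) (add_mset j M - replicate_mset k i))"
    unfolding idx using fin j k add.prems(2) by (subst sum.union_disjoint) auto
  also have "(\<Sum>i | k \<le> count M i. mcoeff (?p \<mu>) (add_mset j M - replicate_mset k i)) =
      (\<Sum>i | k \<le> count M i. of_nat (count \<mu> 1) * mcoeff (?p (\<mu> - {#1#})) (M - replicate_mset k i))"
  proof (rule sum.cong)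
    fix i assume "i \<in> {i. k \<le> count M i}"
    with k j have "i \<noteq> j" by auto
    then have "add_mset j M - replicate_mset k i = add_mset j (M - replicate_mset k i)"
      by (intro multiset_eqI) auto
    then show "mcoeff (?p \<mu>) (add_mset j M - replicate_mset k i) =
        of_nat (count \<mu> 1) * mcoeff (?p (\<mu> - {#1#})) (M - replicate_mset k i)"
      using add.IH[OF \<mu>, of "M - replicate_mset k i"] add.prems by (auto dest: in_diffD)
  qed simp
  also have "\<dots> = of_nat (count \<mu> 1) * mcoeff (?p (add_mset k (\<mu> - {#1#}))) M"
    by (simp add: mcoeff_power_sum_mult[OF k] sum_distrib_left)
  also have "(if k = 1 then mcoeff (?p \<mu>) M else 0) + \<dots> =
      of_nat (count (add_mset k \<mu>) 1) * mcoeff (?p (add_mset k \<mu> - {#1#})) M"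
  proof (cases "k = 1")
    case True
    have "of_nat (count \<mu> 1) * mcoeff (?p (add_mset k (\<mu> - {#1#}))) M = of_nat (count \<mu> 1) * mcoeff (?p \<mu>) M"
      using True by (cases "1 \<in># \<mu>") (simp_all add: not_in_iff del: power_sum_mset_add)
    then show ?thesis using True by (simp add: algebra_simps del: power_sum_mset_add)
  next
    case False
    then show ?thesis by (simp del: power_sum_mset_add)
  qed
  finally show ?case .
qed

lemma mcoeff_power_sum_mset_replicate:
  assumes "0 \<notin># \<mu>"
  shows "mcoeff (power_sum_mset \<mu> :: 'a::comm_ring_1 mseries) (replicate_mset k i) =
    (if sum_mset \<mu> = k then 1 else 0)"
  using assms
proof (induction \<mu> arbitrary: k)
  case empty
  then show ?case by (simp add: mcoeff_one)
next
  case (add l \<mu>)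
  then have l: "l > 0" by auto
  have "{j. l \<le> count (replicate_mset k i) j} = (if l \<le> k then {i} else {})"
    using l by (auto split: if_splits)
  moreover have "replicate_mset k i - replicate_mset l i = replicate_mset (k - l) i"
    by (intro multiset_eqI) auto
  ultimately show ?case
    using add by (auto simp: mcoeff_power_sum_mult[OF l])
qed

text \<open>If \<open>c\<close> is the power sum expansion of \<open>g\<close>, this says that \<open>\<langle>p\<^sub>\<mu>, g\<rangle>\<close> is the coefficient of \<open>M\<close> in
  \<open>p\<^sub>\<mu>\<close>; by linearity, pairing with \<open>g\<close> then extracts the coefficient of \<open>M\<close>.\<close>

definition dual_to_monomial :: "(nat multiset \<Rightarrow> 'a::comm_ring_1) \<Rightarrow> nat multiset \<Rightarrow> bool" where
  "dual_to_monomial c M \<longleftrightarrow>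
    (\<forall>\<mu>. 0 \<notin># \<mu> \<longrightarrow> of_nat (zfactor \<mu>) * c \<mu> = mcoeff (power_sum_mset \<mu>) M)"

lemma hall_inner_dual_to_monomial:
  fixes f g :: "'a::{idom, ring_char_0} mseries"
  assumes f: "f \<in> power_sum_span" and g: "power_sum_expansion g c" and dual: "dual_to_monomial c M"
  shows "hall_inner f g = mcoeff f M"
proof -
  from f obtain a where a: "power_sum_expansion f a" using power_sum_span_expansion by blast
  have summand: "of_nat (zfactor \<mu>) * a \<mu> * c \<mu> = a \<mu> * mcoeff (power_sum_mset \<mu>) M" for \<mu>
  proof (cases "0 \<in># \<mu>")
    case True
    then show ?thesis using a by (simp add: power_sum_expansion_def)
  next
    case False
    then show ?thesis using dual by (simp add: dual_to_monomial_def algebra_simps)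
  qed
  have zero: "a \<mu> * mcoeff (power_sum_mset \<mu>) M = 0" if "\<mu> \<notin> partitions_of (size M)" for \<mu>
    using that a homogeneousD[OF homogeneous_power_sum_mset, of M \<mu>, where 'a = 'a]
    by (auto simp: partitions_of_def power_sum_expansion_def)
  have "hall_inner f g = Sum_any (\<lambda>\<mu>. a \<mu> * mcoeff (power_sum_mset \<mu>) M)"
    unfolding hall_inner_def power_sum_coeffs_eqI[OF a] power_sum_coeffs_eqI[OF g] summand ..
  also have "\<dots> = (\<Sum>\<mu>\<in>partitions_of (size M). a \<mu> * mcoeff (power_sum_mset \<mu>) M)"
    using zero by (intro Sum_any.expand_superset) auto
  also have "\<dots> = mcoeff f M"
    using a by (simp add: power_sum_expansion_def)
  finally show ?thesis .
qed

lemma power_sum_expansion_power_sum_1_mult: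
  fixes g :: "'a::comm_ring_1 mseries"
  assumes "power_sum_expansion g c"
  shows "power_sum_expansion (power_sum 1 * g) (\<lambda>\<mu>. if 1 \<in># \<mu> then c (\<mu> - {#1#}) else 0)"
  unfolding power_sum_expansion_def
proof (intro conjI allI impI)
  fix \<mu> :: "nat multiset" assume "0 \<in># \<mu>"
  then have "0 \<in># \<mu> - {#1#}" by (simp add: in_diff_count)
  then show "(if 1 \<in># \<mu> then c (\<mu> - {#1#}) else 0) = 0"
    using assms by (simp add: power_sum_expansion_def)
next
  fix M :: "nat multiset"
  let ?p = "\<lambda>\<mu>. power_sum_mset \<mu> :: 'a mseries"
  let ?I = "{i. 1 \<le> count M i}"
  have "mcoeff (power_sum 1 * g) M = (\<Sum>i\<in>?I. mcoeff g (M - replicate_mset 1 i))"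
    by (rule mcoeff_power_sum_mult) simp
  also have "\<dots> = (\<Sum>i\<in>?I. \<Sum>\<nu>\<in>partitions_of (size M - 1). c \<nu> * mcoeff (?p \<nu>) (M - replicate_mset 1 i))"
    using assms by (intro sum.cong) (auto simp: power_sum_expansion_def size_Diff_singleton Suc_le_eq)
  also have "\<dots> = (\<Sum>\<nu>\<in>partitions_of (size M - 1). c \<nu> * mcoeff (?p (add_mset 1 \<nu>)) M)"
    unfolding power_sum_mset_add mcoeff_power_sum_mult[OF zero_less_one]
    by (subst sum.swap) (simp add: sum_distrib_left)
  also have "\<dots> = (\<Sum>\<mu>\<in>{\<mu> \<in> partitions_of (size M). 1 \<in># \<mu>}. c (\<mu> - {#1#}) * mcoeff (?p \<mu>) M)"
  proof (cases "M = {#}")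
    case True
    have "mcoeff (?p (add_mset 1 \<nu>)) M = 0" for \<nu>
      unfolding power_sum_mset_add mcoeff_power_sum_mult[OF zero_less_one] using True by simp
    moreover have "{\<mu> \<in> partitions_of (size M). 1 \<in># \<mu>} = {}"
      using True by (auto simp: partitions_of_def)
    ultimately show ?thesis by (simp only: mult_zero_right sum.neutral_const sum.empty)
  next
    case False
    then have M: "0 < size M" by (simp add: nonempty_has_size)
    show ?thesis
    proof (rule sum.reindex_bij_witness[where i = "\<lambda>\<mu>. \<mu> - {#1#}" and j = "add_mset 1"])
      fix \<mu> assume "\<mu> \<in> {\<mu> \<in> partitions_of (size M). 1 \<in># \<mu>}"
      then obtain \<nu> where "\<mu> = add_mset 1 \<nu>" "\<mu> \<in> partitions_of (size M)"
        by (auto dest: multi_member_split)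
      then show "\<mu> - {#1#} \<in> partitions_of (size M - 1)" by (auto simp: partitions_of_def)
    qed (use M in \<open>auto simp: partitions_of_def\<close>)
  qed
  also have "\<dots> = (\<Sum>\<mu>\<in>partitions_of (size M). (if 1 \<in># \<mu> then c (\<mu> - {#1#}) else 0) * mcoeff (?p \<mu>) M)"
    by (rule sum.mono_neutral_cong_left) auto
  finally show "mcoeff (power_sum 1 * g) M = \<dots>" .
qed

text \<open>The factor \<open>h\<^sub>k\<close> takes care of the power of \<open>x\<^sub>i\<close>, because \<open>p\<^sub>\<mu>\<close> in
  the single variable \<open>x\<^sub>i\<close> is a power of \<open>x\<^sub>i\<close>. Each factor \<open>p\<^sub>1\<close> adds one
  more variable: passing from \<open>\<mu>\<close> to \<open>\<mu>\<close> without a part \<open>1\<close> divides \<open>z\<^sub>\<mu>\<close> by the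
  multiplicity of that part, which is also the factor produced by the derivative with respect
  to \<open>p\<^sub>1\<close>.\<close>

lemma exists_homog_expansion:
  fixes i :: nat
  assumes "finite J" "i \<notin> J"
  shows "\<exists>c. power_sum_expansion (power_sum 1 ^ card J * homog_sym k :: 'a::rational_domain mseries) c \<and>
    dual_to_monomial c (replicate_mset k i + mset_set J)"
  using assms
proof (induction J rule: finite_induct)
  case empty
  have "\<exists>u::'a. of_nat (zfactor \<mu>) * u = 1" if "0 \<notin># \<mu>" for \<mu>
    using of_nat_dvd_one[OF zfactor_pos[OF that], where 'a = 'a] by (metis dvdE)
  then obtain w :: "nat multiset \<Rightarrow> 'a" where
    w: "\<And>\<mu>. 0 \<notin># \<mu> \<Longrightarrow> of_nat (zfactor \<mu>) * w \<mu> = 1" by metis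
  define c where "c \<mu> = (if \<mu> \<in> partitions_of k then w \<mu> else 0)" for \<mu>
  have "power_sum_expansion (homog_sym k) c"
    unfolding power_sum_expansion_def
  proof (intro conjI allI impI)
    fix M :: "nat multiset"
    have "mcoeff (homog_sym k) M = (\<Sum>\<mu>\<in>partitions_of k. w \<mu> * mcoeff (power_sum_mset \<mu>) M)"
      by (simp add: homog_sym_power_sums[of w k, OF w] mcoeff_sum)
    also have "\<dots> = (\<Sum>\<mu>\<in>partitions_of (size M). c \<mu> * mcoeff (power_sum_mset \<mu>) M)"
    proof (cases "size M = k")
      case True
      then show ?thesis by (simp add: c_def)
    next
      case False
      have "(\<Sum>\<mu>\<in>partitions_of k. w \<mu> * mcoeff (power_sum_mset \<mu>) M) = 0"
        using homogeneousD[OF homogeneous_power_sum_mset, of M, where 'a = 'a] False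
        by (intro sum.neutral) (simp add: partitions_of_def)
      moreover have "(\<Sum>\<mu>\<in>partitions_of (size M). c \<mu> * mcoeff (power_sum_mset \<mu>) M) = 0"
        using False by (intro sum.neutral) (auto simp: c_def partitions_of_def)
      ultimately show ?thesis by simp
    qed
    finally show "mcoeff (homog_sym k) M = (\<Sum>\<mu>\<in>partitions_of (size M). c \<mu> * mcoeff (power_sum_mset \<mu>) M)" .
  qed (simp add: c_def partitions_of_def)
  moreover have "dual_to_monomial c (replicate_mset k i + mset_set {})"
    using w by (auto simp: dual_to_monomial_def mcoeff_power_sum_mset_replicate c_def partitions_of_def)
  ultimately show ?case by auto
next
  case (insert j J)
  let ?g = "power_sum 1 ^ card J * homog_sym k :: 'a mseries"
  let ?M = "replicate_mset k i + mset_set J"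
  from insert obtain c where c: "power_sum_expansion ?g c" "dual_to_monomial c ?M" by auto
  let ?c = "\<lambda>\<mu>. if 1 \<in># \<mu> then c (\<mu> - {#1#}) else 0"
  have "power_sum_expansion (power_sum 1 ^ card (insert j J) * homog_sym k) ?c"
    using power_sum_expansion_power_sum_1_mult[OF c(1)] insert by (simp add: mult.assoc)
  moreover have "dual_to_monomial ?c (replicate_mset k i + mset_set (insert j J))"
    unfolding dual_to_monomial_def
  proof (intro allI impI)
    fix \<mu> :: "nat multiset" assume \<mu>: "0 \<notin># \<mu>"
    have "j \<notin># ?M" using insert by auto
    then have *: "mcoeff (power_sum_mset \<mu> :: 'a mseries) (replicate_mset k i + mset_set (insert j J)) =
      of_nat (count \<mu> 1) * mcoeff (power_sum_mset (\<mu> - {#1#})) ?M"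
      using mcoeff_power_sum_mset_add_new[OF \<mu> \<open>j \<notin># ?M\<close>, where 'a = 'a] insert by simp
    show "of_nat (zfactor \<mu>) * ?c \<mu> =
      mcoeff (power_sum_mset \<mu>) (replicate_mset k i + mset_set (insert j J))"
    proof (cases "1 \<in># \<mu>")
      case True
      then obtain \<nu> where \<nu>: "\<mu> = add_mset 1 \<nu>" by (meson mset_add)
      have "of_nat (zfactor \<nu>) * c \<nu> = mcoeff (power_sum_mset \<nu>) ?M"
        using c(2) \<mu> \<nu> by (simp add: dual_to_monomial_def)
      then show ?thesis unfolding *
        by (simp add: \<nu> zfactor_add_mset distrib_right mult.assoc del: power_sum_mset_add)
    next
      case False
      then have "count \<mu> 1 = 0" by (simp add: count_eq_zero_iff)
      with False show ?thesis unfolding * by simp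
    qed
  qed
  ultimately show ?case by blast
qed

text \<open>The instance of the duality between complete homogeneous and monomial functions that
  carries the proof. The choice of the variables is free; adding a variable calls for \<open>i = 0\<close>,
  and the comparison with parking functions for an \<open>i\<close> above all elements of \<open>J\<close>.\<close>

theorem hall_inner_homog_sym:
  fixes f :: "'a::rational_domain mseries"
  assumes "f \<in> power_sum_span" "finite J" "i \<notin> J"
  shows "hall_inner f (power_sum 1 ^ card J * homog_sym k) = mcoeff f (replicate_mset k i + mset_set J)"
  using hall_inner_dual_to_monomial[OF assms(1)] exists_homog_expansion[OF assms(2,3), of k, where 'a = 'a]
  by blast


lemma power_sum_1_power: "power_sum 1 ^ j = power_sum_mset (replicate_mset j 1)"
  by (induction j) simp_all

text \<open>Only the power of the right degree contributes.\<close>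

lemma mcoeff_geometric_series_power_sum_1:
  "mcoeff (geometric_series (power_sum 1)) M = mcoeff (power_sum 1 ^ size M) M"
proof -
  have "mcoeff (power_sum 1 ^ j) M = 0" if "j \<noteq> size M" for j
    unfolding power_sum_1_power
    by (rule homogeneousD[OF homogeneous_power_sum_mset]) (use that in simp)
  then have "Sum_any (\<lambda>j. mcoeff (power_sum 1 ^ j) M) = (\<Sum>j\<in>{size M}. mcoeff (power_sum 1 ^ j) M)"
    by (intro Sum_any.expand_superset) auto
  then show ?thesis by (simp add: geometric_series_def Abs_mseries_inverse)
qed

lemma power_sum_expansion_geometric_series:
  "power_sum_expansion (geometric_series (power_sum 1)) (\<lambda>\<mu>. if \<mu> = replicate_mset (size \<mu>) 1 then 1 else 0)"
  unfolding power_sum_expansion_def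
proof (intro conjI allI impI)
  fix \<mu> :: "nat multiset"
  assume "0 \<in># \<mu>"
  then have "\<mu> \<noteq> replicate_mset (size \<mu>) 1"
    by (metis in_replicate_mset zero_neq_one)
  then show "(if \<mu> = replicate_mset (size \<mu>) 1 then 1 else 0) = (0 :: 'a)" by simp
next
  fix M :: "nat multiset"
  let ?p = "\<lambda>\<mu>. mcoeff (power_sum_mset \<mu> :: 'a mseries) M"
  have "(\<Sum>\<mu>\<in>partitions_of (size M). (if \<mu> = replicate_mset (size \<mu>) 1 then 1 else 0) * ?p \<mu>) =
      (\<Sum>\<mu>\<in>{replicate_mset (size M) 1}. ?p \<mu>)"
  proof (rule sum.mono_neutral_cong_right)
    show "{replicate_mset (size M) 1} \<subseteq> partitions_of (size M)"
      by (auto simp: partitions_of_def)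
    have "\<mu> = replicate_mset (size M) 1"
      if "\<mu> \<in> partitions_of (size M)" "\<mu> = replicate_mset (size \<mu>) 1" for \<mu>
    proof -
      have "sum_mset \<mu> = size \<mu>" by (subst that(2)) simp
      with that show ?thesis by (simp add: partitions_of_def)
    qed
    then show "\<forall>\<mu>\<in>partitions_of (size M) - {replicate_mset (size M) 1}.
        (if \<mu> = replicate_mset (size \<mu>) 1 then 1 else 0) * ?p \<mu> = 0" by auto
  qed auto
  then have eq: "(\<Sum>\<mu>\<in>partitions_of (size M). (if \<mu> = replicate_mset (size \<mu>) 1 then 1 else 0) * ?p \<mu>) =
      ?p (replicate_mset (size M) 1)" by simp
  show "mcoeff (geometric_series (power_sum 1)) M =
      (\<Sum>\<mu>\<in>partitions_of (size M). (if \<mu> = replicate_mset (size \<mu>) 1 then 1 else 0) * ?p \<mu>)"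
    by (simp only: mcoeff_geometric_series_power_sum_1 power_sum_1_power eq)
qed

text \<open>Both sides are the scalar product of \<open>f\<close> with \<open>p\<^sub>1\<^sup>j\<close>, on the left by
  definition and on the right by duality with \<open>k = 0\<close>.\<close>

lemma hall_inner_power_sum_1_power:
  fixes f :: "'a::rational_domain mseries"
  assumes "f \<in> power_sum_span" and a: "power_sum_expansion f a"
  shows "of_nat (fact j) * a (replicate_mset j 1) = mcoeff f (mset_set {..<j})"
proof -
  let ?\<nu> = "replicate_mset j (1::nat)"
  have e: "power_sum_expansion (power_sum 1 ^ j) (\<lambda>\<nu>. if \<nu> = ?\<nu> then 1 else 0 :: 'a)"
    unfolding power_sum_1_power by (rule power_sum_expansion_power_sum_mset) auto
  have "hall_inner f (power_sum 1 ^ j) =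
      Sum_any (\<lambda>\<mu>. of_nat (zfactor \<mu>) * a \<mu> * (if \<mu> = ?\<nu> then 1 else 0))"
    by (simp only: hall_inner_def power_sum_coeffs_eqI[OF a] power_sum_coeffs_eqI[OF e])
  also have "\<dots> = (\<Sum>\<mu>\<in>{?\<nu>}. of_nat (zfactor \<mu>) * a \<mu> * (if \<mu> = ?\<nu> then 1 else 0))"
    by (intro Sum_any.expand_superset) auto
  also have "\<dots> = of_nat (fact j) * a ?\<nu>"
    by (auto simp: zfactor_def)
  finally show ?thesis
    using hall_inner_homog_sym[OF assms(1), of "{..<j}" j 0] by (simp add: homog_sym_0)
qed

text \<open>The coefficient in degree \<open>j\<close> is the scalar product with \<open>p\<^sub>1\<^sup>j\<close>. The bound
  on the degree makes the sum finite.\<close>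

theorem hall_inner_geometric_series:
  fixes f :: "'a::rational_domain mseries"
  assumes f: "f \<in> power_sum_span" and bound: "\<And>M. size M > n \<Longrightarrow> mcoeff f M = 0"
  shows "hall_inner f (geometric_series (power_sum 1)) = (\<Sum>j\<le>n. mcoeff f (mset_set {..<j}))"
proof -
  from f obtain a where a: "power_sum_expansion f a" using power_sum_span_expansion by blast
  let ?\<nu> = "\<lambda>j. replicate_mset j (1::nat)"
  let ?t = "\<lambda>\<mu>. of_nat (zfactor \<mu>) * a \<mu> * (if \<mu> = ?\<nu> (size \<mu>) then 1 else 0)"
  have t: "?t (?\<nu> j) = mcoeff f (mset_set {..<j})" for j
    unfolding hall_inner_power_sum_1_power[OF f a, symmetric] by (auto simp: zfactor_def)
  have "hall_inner f (geometric_series (power_sum 1)) = Sum_any ?t"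
    by (simp only: hall_inner_def power_sum_coeffs_eqI[OF a]
        power_sum_coeffs_eqI[OF power_sum_expansion_geometric_series])
  also have "\<dots> = sum ?t (?\<nu> ` {..n})"
  proof (rule Sum_any.expand_superset)
    show "{\<mu>. ?t \<mu> \<noteq> 0} \<subseteq> ?\<nu> ` {..n}"
    proof
      fix \<mu> assume "\<mu> \<in> {\<mu>. ?t \<mu> \<noteq> 0}"
      then have nz: "?t \<mu> \<noteq> 0" by simp
      then have \<mu>: "\<mu> = ?\<nu> (size \<mu>)" by (metis mult_zero_right)
      with nz have "mcoeff f (mset_set {..<size \<mu>}) \<noteq> 0" using t[of "size \<mu>"] by metis
      then have "size \<mu> \<le> n" using bound[of "mset_set {..<size \<mu>}"] by fastforce
      with \<mu> show "\<mu> \<in> ?\<nu> ` {..n}" by blast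
    qed
  qed simp
  also have "\<dots> = (\<Sum>j\<le>n. mcoeff f (mset_set {..<j}))"
  proof (subst sum.reindex)
    show "inj_on ?\<nu> {..n}" by (metis inj_onI size_replicate_mset)
  qed (simp only: o_def t)
  finally show ?thesis .
qed


section \<open>Adding a variable\<close>

text \<open>Homogeneity leaves a single possible exponent of \<open>y\<close>.\<close>

lemma mcoeff_add_variable:
  assumes "homogeneous d f"
  shows "mcoeff (add_variable f y) M = (if size M \<le> d then
    mcoeff f (replicate_mset (d - size M) 0 + image_mset Suc M) * y ^ (d - size M) else 0)"
proof -
  let ?t = "\<lambda>j. mcoeff f (replicate_mset j 0 + image_mset Suc M) * y ^ j"
  have "mcoeff (add_variable f y) M = Sum_any ?t"
    by (simp add: add_variable.rep_eq)
  also have "\<dots> = (if size M \<le> d then ?t (d - size M) else 0)"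
  proof (cases "size M \<le> d")
    case True
    have "j = d - size M" if "?t j \<noteq> 0" for j
    proof -
      have "size (replicate_mset j 0 + image_mset Suc M) = d"
        using that assms unfolding homogeneous_def by (metis mult_zero_left)
      then show ?thesis by simp
    qed
    then have "Sum_any ?t = sum ?t {d - size M}"
      by (intro Sum_any.expand_superset) auto
    then show ?thesis using True by simp
  next
    case False
    then have "?t j = 0" for j by (simp add: homogeneousD[OF assms])
    then show ?thesis using False by simp
  qed
  finally show ?thesis .
qed

text \<open>This is \<open>p\<^sub>k(\<^bold>x + y) = p\<^sub>k(\<^bold>x) + y\<^sup>k\<close> together with
  multiplicativity of the substitution in the one case that is needed. On coefficients, the
  variable chosen by \<open>p\<^sub>k\<close> is either \<open>x\<^sub>0\<close>, which becomes \<open>y\<close>, or one of the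
  shifted variables.\<close>

lemma add_variable_power_sum_mult:
  fixes g :: "'a::comm_ring_1 mseries"
  assumes g: "homogeneous e g" and pg: "homogeneous (k + e) (power_sum k * g)" and k: "k > 0"
  shows "add_variable (power_sum k * g) y = (power_sum k + mconst (y ^ k)) * add_variable g y"
proof (rule mseries_eqI)
  fix M :: "nat multiset"
  \<comment> \<open>the exponent of \<open>y\<close> at \<open>M\<close>, hence of \<open>x\<^sub>0\<close> in the monomial \<open>?N\<close> before the substitution\<close>
  define r where "r = k + e - size M"
  let ?N = "replicate_mset r 0 + image_mset Suc M"
  have cnt: "count (image_mset Suc M) (Suc i) = count M i" "count (image_mset Suc M) 0 = 0" for i
    by (induction M) auto
  have idx: "{i. k \<le> count ?N i} = (if k \<le> r then {0} else {}) \<union> Suc ` {i. k \<le> count M i}"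
  proof (rule set_eqI)
    fix i show "i \<in> {i. k \<le> count ?N i} \<longleftrightarrow> i \<in> (if k \<le> r then {0} else {}) \<union> Suc ` {i. k \<le> count M i}"
      using k by (cases i) (auto simp: cnt)
  qed
  have diff0: "?N - replicate_mset k 0 = replicate_mset (r - k) 0 + image_mset Suc M" if "k \<le> r"
    using that by (intro multiset_eqI) auto
  have diffS: "?N - replicate_mset k (Suc i) = replicate_mset r 0 + image_mset Suc (M - replicate_mset k i)"
    if "k \<le> count M i" for i
  proof -
    have "image_mset Suc M = image_mset Suc (M - replicate_mset k i) + replicate_mset k (Suc i)"
      using that
      by (metis count_le_replicate_mset_subset_eq image_mset_union image_replicate_mset subset_mset.diff_add)
    then show ?thesis by simp
  qed
  have coeff: "mcoeff (power_sum k * g) ?N =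
      (if k \<le> r then mcoeff g (replicate_mset (r - k) 0 + image_mset Suc M) else 0) +
      (\<Sum>i | k \<le> count M i. mcoeff g (replicate_mset r 0 + image_mset Suc (M - replicate_mset k i)))"
    (is "_ = ?a + ?b")
  proof -
    have "mcoeff (power_sum k * g) ?N = (\<Sum>i | k \<le> count ?N i. mcoeff g (?N - replicate_mset k i))"
      by (rule mcoeff_power_sum_mult[OF k])
    also have "\<dots> = (\<Sum>i\<in>(if k \<le> r then {0} else {}). mcoeff g (?N - replicate_mset k i)) +
        (\<Sum>i\<in>Suc ` {i. k \<le> count M i}. mcoeff g (?N - replicate_mset k i))"
      unfolding idx by (rule sum.union_disjoint) (use finite_le_count[OF k, of M] in auto)
    also have "(\<Sum>i\<in>(if k \<le> r then {0} else {}). mcoeff g (?N - replicate_mset k i)) = ?a"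
      using diff0 by simp
    also have "(\<Sum>i\<in>Suc ` {i. k \<le> count M i}. mcoeff g (?N - replicate_mset k i)) = ?b"
      by (subst sum.reindex) (auto simp: diffS intro!: sum.cong)
    finally show ?thesis .
  qed
  have IH: "(if size M \<le> k + e then y ^ r * mcoeff g (replicate_mset r 0 + image_mset Suc (M - replicate_mset k i)) else 0) =
      mcoeff (add_variable g y) (M - replicate_mset k i)" if "k \<le> count M i" for i
  proof -
    have sz: "size (M - replicate_mset k i) = size M - k" "k \<le> size M"
      using that count_le_size[of M i]
      by (simp add: size_Diff_submset count_le_replicate_mset_subset_eq, linarith)
    have "e - (size M - k) = r" "size M - k \<le> e \<longleftrightarrow> size M \<le> k + e"
      using sz(2) by (auto simp: r_def)
    then show ?thesis
      unfolding mcoeff_add_variable[OF g] sz(1) by (simp add: mult.commute)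
  qed
  have y: "(if size M \<le> k + e then y ^ r * ?a else 0) = y ^ k * mcoeff (add_variable g y) M"
  proof (cases "size M \<le> e")
    case True
    then have "r - k = e - size M" "k \<le> r" "size M \<le> k + e" "y ^ r = y ^ k * y ^ (e - size M)"
      by (auto simp: r_def simp flip: power_add)
    with True show ?thesis unfolding mcoeff_add_variable[OF g] by simp
  next
    case False
    then have "k \<le> r \<Longrightarrow> \<not> size M \<le> k + e" using k by (auto simp: r_def)
    with False show ?thesis unfolding mcoeff_add_variable[OF g] by auto
  qed
  have "mcoeff (add_variable (power_sum k * g) y) M = (if size M \<le> k + e then y ^ r * (?a + ?b) else 0)"
    unfolding mcoeff_add_variable[OF pg] r_def[symmetric] coeff by (simp only: mult.commute)
  also have "\<dots> = (if size M \<le> k + e then y ^ r * ?a else 0) + (\<Sum>i | k \<le> count M i.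
      if size M \<le> k + e then y ^ r * mcoeff g (replicate_mset r 0 + image_mset Suc (M - replicate_mset k i)) else 0)"
    by (simp add: distrib_left sum_distrib_left)
  also have "\<dots> = y ^ k * mcoeff (add_variable g y) M +
      (\<Sum>i | k \<le> count M i. mcoeff (add_variable g y) (M - replicate_mset k i))"
    unfolding y using IH by simp
  also have "\<dots> = mcoeff ((power_sum k + mconst (y ^ k)) * add_variable g y) M"
    by (simp add: distrib_right mcoeff_power_sum_mult[OF k])
  finally show "mcoeff (add_variable (power_sum k * g) y) M =
      mcoeff ((power_sum k + mconst (y ^ k)) * add_variable g y) M" .
qed

lemma add_variable_power_sum_mset:
  assumes "0 \<notin># \<mu>"
  shows "add_variable (power_sum_mset \<mu>) y \<in> power_sum_span"
  using assms
proof (induction \<mu>)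
  case empty
  have "homogeneous 0 (1 :: 'a mseries)" by (auto simp: homogeneous_def mcoeff_one)
  then have "add_variable 1 y = 1"
    by (intro mseries_eqI) (auto simp: mcoeff_add_variable mcoeff_one)
  then show ?case by (simp add: power_sum_span_one)
next
  case (add k \<mu>)
  have k: "k > 0" using add.prems by auto
  have "add_variable (power_sum k * power_sum_mset \<mu>) y =
      (power_sum k + mconst (y ^ k)) * add_variable (power_sum_mset \<mu>) y"
    using homogeneous_power_sum_mset[of "add_mset k \<mu>"]
    by (intro add_variable_power_sum_mult[OF homogeneous_power_sum_mset _ k]) simp
  also have "\<dots> \<in> power_sum_span"
    using add k power_sum_span_mconst_mult[OF power_sum_span_one, of "y ^ k"]
    by (intro power_sum_span_mult power_sum_span_add power_sum_span_power_sum) auto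
  finally show ?case by simp
qed

lemma add_variable_in_power_sum_span:
  fixes f :: "'a::comm_ring_1 mseries"
  assumes f: "f \<in> power_sum_span" and hom: "homogeneous d f"
  shows "add_variable f y \<in> power_sum_span"
proof -
  from f obtain c where c: "power_sum_expansion f c" using power_sum_span_expansion by blast
  have coeff: "mcoeff f M = (\<Sum>\<mu>\<in>partitions_of d. c \<mu> * mcoeff (power_sum_mset \<mu>) M)"
    if "size M = d" for M
    using c that by (auto simp: power_sum_expansion_def)
  have "add_variable f y = (\<Sum>\<mu>\<in>partitions_of d. mconst (c \<mu>) * add_variable (power_sum_mset \<mu>) y)"
  proof (rule mseries_eqI)
    fix M :: "nat multiset"
    have hom': "homogeneous d (power_sum_mset \<mu> :: 'a mseries)" if "\<mu> \<in> partitions_of d" for \<mu>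
      using homogeneous_power_sum_mset[of \<mu>] that by (simp add: partitions_of_def)
    have "mcoeff (\<Sum>\<mu>\<in>partitions_of d. mconst (c \<mu>) * add_variable (power_sum_mset \<mu>) y) M =
      (\<Sum>\<mu>\<in>partitions_of d. c \<mu> * (if size M \<le> d then
          mcoeff (power_sum_mset \<mu>) (replicate_mset (d - size M) 0 + image_mset Suc M) * y ^ (d - size M) else 0))"
      unfolding mcoeff_sum mcoeff_mconst_mult by (intro sum.cong) (simp_all only: mcoeff_add_variable[OF hom'])
    also have "\<dots> = mcoeff (add_variable f y) M"
      by (auto simp: mcoeff_add_variable[OF hom] coeff sum_distrib_right mult.assoc)
    finally show "mcoeff (add_variable f y) M =
      mcoeff (\<Sum>\<mu>\<in>partitions_of d. mconst (c \<mu>) * add_variable (power_sum_mset \<mu>) y) M" ..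
  qed
  also have "\<dots> \<in> power_sum_span"
    by (intro power_sum_span_sum power_sum_span_mconst_mult add_variable_power_sum_mset)
       (simp add: partitions_of_def)
  finally show ?thesis .
qed

text \<open>In \<open>f(\<^bold>x + y)\<close> the monomial \<open>x\<^sub>0 \<dots> x\<^sub>j\<^sub>-\<^sub>1\<close> has
  coefficient \<open>y\<^sup>n\<^sup>-\<^sup>j\<close> times that of \<open>x\<^sub>0\<^sup>n\<^sup>-\<^sup>j
  x\<^sub>1 \<dots> x\<^sub>j\<close> in \<open>f\<close>, and duality turns this back into a scalar product.\<close>

theorem hall_inner_add_variable:
  fixes f :: "'a::rational_domain mseries"
  assumes f: "f \<in> power_sum_span" and hom: "homogeneous n f"
  shows "hall_inner (add_variable f y) (geometric_series (power_sum 1)) =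
    (\<Sum>k\<le>n. hall_inner f (power_sum 1 ^ (n - k) * homog_sym k) * y ^ k)"
proof -
  have "hall_inner (add_variable f y) (geometric_series (power_sum 1)) =
      (\<Sum>j\<le>n. mcoeff (add_variable f y) (mset_set {..<j}))"
    by (rule hall_inner_geometric_series)
       (use add_variable_in_power_sum_span[OF f hom] in \<open>auto simp: mcoeff_add_variable[OF hom]\<close>)
  also have "\<dots> = (\<Sum>j\<le>n. hall_inner f (power_sum 1 ^ j * homog_sym (n - j)) * y ^ (n - j))"
  proof (rule sum.cong)
    fix j assume j: "j \<in> {..n}"
    have "image_mset Suc (mset_set {..<j}) = mset_set (Suc ` {..<j})"
      by (rule image_mset_mset_set) simp
    then show "mcoeff (add_variable f y) (mset_set {..<j}) =
        hall_inner f (power_sum 1 ^ j * homog_sym (n - j)) * y ^ (n - j)"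
      using j hall_inner_homog_sym[OF f, of "Suc ` {..<j}" 0 "n - j"]
      by (simp add: mcoeff_add_variable[OF hom] card_image)
  qed simp
  also have "\<dots> = (\<Sum>k\<le>n. hall_inner f (power_sum 1 ^ (n - k) * homog_sym k) * y ^ k)"
    by (rule sum.reindex_bij_witness[where i = "\<lambda>k. n - k" and j = "\<lambda>k. n - k"]) auto
  finally show ?thesis .
qed


section \<open>Labelings of the up steps\<close>

text \<open>The elements of \<open>U\<close> are positions of up steps and \<open>M\<close> is the content, the multiset of
  labels used. Unlike in a parking function, a label may repeat in different risers.\<close>

definition labelings :: "nat set \<Rightarrow> nat multiset \<Rightarrow> (nat \<Rightarrow> nat) set" where
  "labelings U M = {l \<in> extensional U.
     image_mset l (mset_set U) = M \<and> (\<forall>i. i \<in> U \<and> Suc i \<in> U \<longrightarrow> l i < l (Suc i))}"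

text \<open>The risers of a path depend only on the set of positions of its up steps; for arbitrary
  sets of positions the risers can be removed one at a time.\<close>

definition runs :: "nat set \<Rightarrow> (nat \<times> nat) set" where
  "runs U = {(i, j). i < j \<and> {i..<j} \<subseteq> U \<and> (i = 0 \<or> i - 1 \<notin> U) \<and> j \<notin> U}"

lemma finite_labelings:
  assumes "finite U"
  shows "finite (labelings U M)"
proof (rule finite_subset)
  show "labelings U M \<subseteq> (\<Pi>\<^sub>E i\<in>U. set_mset M)"
    using assms by (auto simp: labelings_def PiE_def)
qed (use assms in \<open>auto intro: finite_PiE\<close>)

text \<open>A labeling whose content is a set uses every element once, so it is a bijection.\<close>

lemma parking_functions_eq_labelings:
  assumes "finite (up_steps ps)"
  shows "parking_functions n ps = labelings (up_steps ps) (mset_set {1..n - diag ps})"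
proof -
  have "bij_betw l (up_steps ps) A \<longleftrightarrow> image_mset l (mset_set (up_steps ps)) = mset_set A"
    if "finite A" for l and A :: "nat set"
  proof
    assume "bij_betw l (up_steps ps) A"
    then show "image_mset l (mset_set (up_steps ps)) = mset_set A"
      by (simp add: bij_betw_def image_mset_mset_set)
  next
    assume eq: "image_mset l (mset_set (up_steps ps)) = mset_set A"
    have "l ` up_steps ps = A"
      using arg_cong[OF eq, of set_mset] assms that by simp
    moreover have "card (up_steps ps) = card A"
      using arg_cong[OF eq, of size] by simp
    ultimately show "bij_betw l (up_steps ps) A"
      using assms by (simp add: bij_betw_def eq_card_imp_inj_on)
  qed
  then show ?thesis
    unfolding parking_functions_def labelings_def by auto
qed

text \<open>A strictly increasing sequence is determined by the set of its values. So there is one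
  labeling for each monomial of \<open>e\<^sub>b\<^sub>-\<^sub>a\<close>.\<close>

lemma labelings_interval:
  "card (labelings {a..<b} A) = (if size A = b - a \<and> (\<forall>i. count A i \<le> 1) then 1 else 0)"
proof -
  have image: "image_mset l (mset_set {a..<b}) = mset (map l [a..<b])" for l :: "nat \<Rightarrow> nat"
    by (metis mset_map mset_upt)
  have mono: "(\<forall>i. i \<in> {a..<b} \<and> Suc i \<in> {a..<b} \<longrightarrow> l i < l (Suc i)) \<longleftrightarrow> sorted_wrt (<) (map l [a..<b])"
    for l :: "nat \<Rightarrow> nat"
  proof -
    have "sorted_wrt (<) (map l [a..<b]) \<longleftrightarrow> (\<forall>i. Suc i < b - a \<longrightarrow> l (a + i) < l (a + Suc i))"
      by (subst sorted_wrt_iff_nth_Suc_transp) auto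
    also have "\<dots> \<longleftrightarrow> (\<forall>i. i \<in> {a..<b} \<and> Suc i \<in> {a..<b} \<longrightarrow> l i < l (Suc i))"
    proof safe
      fix i assume "\<forall>i. Suc i < b - a \<longrightarrow> l (a + i) < l (a + Suc i)" "i \<in> {a..<b}" "Suc i \<in> {a..<b}"
      then show "l i < l (Suc i)" by (auto dest!: spec[of _ "i - a"])
    next
      fix i assume "\<forall>i. i \<in> {a..<b} \<and> Suc i \<in> {a..<b} \<longrightarrow> l i < l (Suc i)" "Suc i < b - a"
      then show "l (a + i) < l (a + Suc i)" by (auto dest!: spec[of _ "a + i"])
    qed
    finally show ?thesis ..
  qed
  show ?thesis
  proof (cases "size A = b - a \<and> (\<forall>i. count A i \<le> 1)")
    case True
    let ?xs = "sorted_list_of_multiset A"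
    have len: "length ?xs = b - a" using True by (metis mset_sorted_list_of_multiset size_mset)
    have "distinct ?xs"
      using True by (auto simp: distinct_count_atmost_1 simp flip: count_mset split: if_splits)
        (metis One_nat_def Suc_leI count_greater_zero_iff count_mset le_antisym mset_sorted_list_of_multiset not_gr_zero count_inI)+
    then have strict: "sorted_wrt (<) ?xs"
      by (simp add: strict_sorted_iff)
    define l0 where "l0 = restrict (\<lambda>i. ?xs ! (i - a)) {a..<b}"
    have l0: "map l0 [a..<b] = ?xs"
      by (rule nth_equalityI) (auto simp: len l0_def)
    have "labelings {a..<b} A = {l0}"
    proof (intro equalityI subsetI)
      fix l assume l: "l \<in> labelings {a..<b} A"
      then have "sorted_wrt (<) (map l [a..<b])" "mset (map l [a..<b]) = A"
        unfolding labelings_def mono image by auto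
      then have "map l [a..<b] = ?xs"
        by (metis strict_sorted_iff sorted_list_of_multiset_mset sorted_sort_id)
      then have "map l [a..<b] = map l0 [a..<b]" by (simp only: l0)
      then have "l i = l0 i" if "i \<in> {a..<b}" for i using that by auto
      then show "l \<in> {l0}"
        using l by (auto simp: labelings_def l0_def intro: extensionalityI)
    next
      fix l assume "l \<in> {l0}"
      then show "l \<in> labelings {a..<b} A"
        unfolding labelings_def mono image by (auto simp only: l0 strict) (auto simp: l0_def)
    qed
    with True show ?thesis by simp
  next
    case False
    have "labelings {a..<b} A = {}"
    proof (rule ccontr)
      assume "labelings {a..<b} A \<noteq> {}"
      then obtain l where l: "sorted_wrt (<) (map l [a..<b])" "mset (map l [a..<b]) = A"
        unfolding labelings_def mono image by auto
      then have "distinct (map l [a..<b])" by (simp add: strict_sorted_iff)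
      then have "count A i \<le> 1" for i
        using l(2) by (metis distinct_count_atmost_1 le_refl zero_le)
      moreover have "size A = b - a" using l(2) by (metis length_map length_upt size_mset)
      ultimately show False using False by blast
    qed
    then show ?thesis using False by simp
  qed
qed

text \<open>The gap between \<open>U\<close> and the interval means that no condition links their labels, so a
  labeling of the union is a pair of labelings whose contents add up to \<open>M\<close>, as in a product of
  two series.\<close>

lemma labelings_union:
  assumes "finite U" "\<And>x. x \<in> U \<Longrightarrow> Suc x < a"
  shows "card (labelings ({a..<b} \<union> U) M) =
    (\<Sum>(A, B)\<in>splits M. card (labelings {a..<b} A) * card (labelings U B))"
proof -
  let ?I = "{a..<b}"
  have disj: "?I \<inter> U = {}" using assms(2) by fastforce
  let ?f = "\<lambda>l. (restrict l ?I, restrict l U)"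
  let ?S = "SIGMA p:splits M. labelings ?I (fst p) \<times> labelings U (snd p)"
  have image: "image_mset l (mset_set (?I \<union> U)) =
      image_mset l (mset_set ?I) + image_mset l (mset_set U)" for l :: "nat \<Rightarrow> nat"
    using disj assms(1) by (simp add: mset_set_Union)
  have restr: "image_mset (restrict l X) (mset_set X) = image_mset l (mset_set X)"
    if "finite X" for l :: "nat \<Rightarrow> nat" and X
    by (rule image_mset_cong) (use that in auto)
  have mono: "(\<forall>i. i \<in> ?I \<union> U \<and> Suc i \<in> ?I \<union> U \<longrightarrow> l i < l (Suc i)) \<longleftrightarrow>
      (\<forall>i. i \<in> ?I \<and> Suc i \<in> ?I \<longrightarrow> l i < l (Suc i)) \<and>
      (\<forall>i. i \<in> U \<and> Suc i \<in> U \<longrightarrow> l i < l (Suc i))" for l :: "nat \<Rightarrow> nat"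
  proof -
    have "\<not> (i \<in> U \<and> Suc i \<in> ?I)" "\<not> (i \<in> ?I \<and> Suc i \<in> U)" for i
      using assms(2) by fastforce+
    then show ?thesis by blast
  qed
  \<comment> \<open>the contents of the two parts are recorded to index the pairs by the splittings of \<open>M\<close>\<close>
  have bij: "bij_betw (\<lambda>l. ((image_mset l (mset_set ?I), image_mset l (mset_set U)), ?f l))
      (labelings (?I \<union> U) M) ?S"
  proof (rule bij_betw_byWitness[where f' = "\<lambda>(p, g, h). restrict (\<lambda>i. if i \<in> ?I then g i else h i) (?I \<union> U)"])
    show "\<forall>l\<in>labelings (?I \<union> U) M.
        (\<lambda>(p, g, h). restrict (\<lambda>i. if i \<in> ?I then g i else h i) (?I \<union> U))
          ((image_mset l (mset_set ?I), image_mset l (mset_set U)), ?f l) = l"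
      by (auto simp: labelings_def fun_eq_iff extensional_def)
  next
    show "\<forall>x\<in>?S. (\<lambda>l. ((image_mset l (mset_set ?I), image_mset l (mset_set U)), ?f l))
        ((\<lambda>(p, g, h). restrict (\<lambda>i. if i \<in> ?I then g i else h i) (?I \<union> U)) x) = x"
    proof
      fix x assume "x \<in> ?S"
      then obtain A B g h where x: "x = ((A, B), g, h)" "g \<in> labelings ?I A" "h \<in> labelings U B"
        by auto
      let ?l = "restrict (\<lambda>i. if i \<in> ?I then g i else h i) (?I \<union> U)"
      have g: "restrict ?l ?I = g"
        using x(2) by (auto simp: labelings_def fun_eq_iff extensional_def)
      have h: "restrict ?l U = h"
        using x(3) disj by (auto simp: labelings_def fun_eq_iff extensional_def)
      have "image_mset ?l (mset_set ?I) = A" "image_mset ?l (mset_set U) = B"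
        using x restr[of ?I ?l] restr[of U ?l] assms(1) unfolding g h by (auto simp: labelings_def)
      then show "(\<lambda>l. ((image_mset l (mset_set ?I), image_mset l (mset_set U)), ?f l))
        ((\<lambda>(p, g, h). restrict (\<lambda>i. if i \<in> ?I then g i else h i) (?I \<union> U)) x) = x"
        using g h x(1) by simp
    qed
  next
    show "(\<lambda>l. ((image_mset l (mset_set ?I), image_mset l (mset_set U)), ?f l)) `
        labelings (?I \<union> U) M \<subseteq> ?S"
    proof
      fix x assume "x \<in> (\<lambda>l. ((image_mset l (mset_set ?I), image_mset l (mset_set U)), ?f l)) `
        labelings (?I \<union> U) M"
      then obtain l where l: "l \<in> labelings (?I \<union> U) M"
        "x = ((image_mset l (mset_set ?I), image_mset l (mset_set U)), ?f l)" by blast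
      have "restrict l X \<in> labelings X (image_mset l (mset_set X))" if "X \<in> {?I, U}" for X
        using l(1) that assms(1) restr[of X l] unfolding labelings_def mono by auto
      moreover have "image_mset l (mset_set ?I) + image_mset l (mset_set U) = M"
        using l(1) by (simp add: labelings_def image)
      ultimately show "x \<in> ?S" using l(2) by (simp add: splits_def)
    qed
  next
    show "(\<lambda>(p, g, h). restrict (\<lambda>i. if i \<in> ?I then g i else h i) (?I \<union> U)) ` ?S \<subseteq> labelings (?I \<union> U) M"
    proof
      fix l assume "l \<in> (\<lambda>(p, g, h). restrict (\<lambda>i. if i \<in> ?I then g i else h i) (?I \<union> U)) ` ?S"
      then obtain A B g h where x: "A + B = M" "g \<in> labelings ?I A" "h \<in> labelings U B"
        and l: "l = restrict (\<lambda>i. if i \<in> ?I then g i else h i) (?I \<union> U)"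
        by (auto simp: splits_def)
      have lg: "l i = g i" if "i \<in> ?I" for i using that by (simp add: l)
      have lh: "l i = h i" if "i \<in> U" for i using that disj by (auto simp: l)
      have "image_mset l (mset_set ?I) = image_mset g (mset_set ?I)"
        by (rule image_mset_cong) (simp add: lg)
      moreover have "image_mset l (mset_set U) = image_mset h (mset_set U)"
        by (rule image_mset_cong) (simp add: lh assms(1))
      ultimately show "l \<in> labelings (?I \<union> U) M"
        using x unfolding labelings_def mono image by (simp add: lg lh) (simp add: l)
    qed
  qed
  have "card (labelings (?I \<union> U) M) = card ?S"
    using bij by (rule bij_betw_same_card)
  also have "\<dots> = (\<Sum>p\<in>splits M. card (labelings ?I (fst p)) * card (labelings U (snd p)))"
    by (subst card_SigmaI) (auto simp: finite_labelings assms(1) card_cartesian_product)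
  finally show ?thesis by (simp add: case_prod_unfold)
qed

lemma runs_union:
  assumes "a < b" "\<And>x. x \<in> U \<Longrightarrow> Suc x < a"
  shows "runs ({a..<b} \<union> U) = insert (a, b) (runs U)" and "(a, b) \<notin> runs U"
proof -
  show "(a, b) \<notin> runs U" using assms unfolding runs_def by fastforce
  have 1: "(i, j) \<in> insert (a, b) (runs U)" if ij: "(i, j) \<in> runs ({a..<b} \<union> U)" for i j
  proof -
    have r: "i < j" "{i..<j} \<subseteq> {a..<b} \<union> U" "i = 0 \<or> i - 1 \<notin> {a..<b} \<union> U" "j \<notin> {a..<b} \<union> U"
      using ij by (auto simp: runs_def)
    show ?thesis
    proof (cases "i < a")
      case True
      then have "i \<in> U" using r(1,2) by fastforce
      have "j < a"
      proof (rule ccontr)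
        assume "\<not> j < a"
        then have "a - 1 \<in> {i..<j}" using True by auto
        then have "a - 1 \<in> {a..<b} \<union> U" using r(2) by blast
        then have "a - 1 \<in> U" using True by auto
        then show False using assms(2)[of "a - 1"] True by simp
      qed
      then have "{i..<j} \<subseteq> U" using r(2) by fastforce
      then show ?thesis using r by (auto simp: runs_def)
    next
      case False
      then have "i \<in> {a..<b}" using r(1,2) assms(2)[of i] by fastforce
      then have "i = a" using r(3) by fastforce
      moreover have "j = b"
      proof (rule ccontr)
        assume "j \<noteq> b"
        moreover have "\<not> j < b" using r(1,4) \<open>i = a\<close> by auto
        ultimately have "b \<in> {i..<j}" using \<open>i = a\<close> assms(1) by auto
        then have "b \<in> U" using r(2) by auto
        then show False using assms(1) assms(2)[of b] by simp
      qed
      ultimately show ?thesis by simp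
    qed
  qed
  have 2: "(i, j) \<in> runs ({a..<b} \<union> U)" if "(i, j) \<in> runs U" for i j
  proof -
    have r: "i < j" "{i..<j} \<subseteq> U" "i = 0 \<or> i - 1 \<notin> U" "j \<notin> U"
      using that by (auto simp: runs_def)
    then have "j - 1 \<in> U" by auto
    then have "j < a" using assms(2)[of "j - 1"] r(1) by simp
    then show ?thesis using r by (auto simp: runs_def)
  qed
  have 3: "(a, b) \<in> runs ({a..<b} \<union> U)"
    using assms(1) assms(2)[of "a - 1"] assms(2)[of b] by (auto simp: runs_def)
  show "runs ({a..<b} \<union> U) = insert (a, b) (runs U)"
    using 1 2 3 by auto
qed

text \<open>The last run ends at \<open>Max U\<close> and starts at the least \<open>a\<close> with \<open>{a..Max U} \<subseteq> U\<close>; by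
  minimality \<open>a - 1\<close> is missing, which is the gap.\<close>

lemma last_run:
  assumes "finite U" "U \<noteq> {}"
  obtains a b U' where "a < b" "U = {a..<b} \<union> U'" "U' \<subset> U" "\<And>x. x \<in> U' \<Longrightarrow> Suc x < a"
proof -
  define m where "m = Max U"
  define a where "a = (LEAST a. {a..m} \<subseteq> U)"
  have m: "m \<in> U" "\<And>x. x \<in> U \<Longrightarrow> x \<le> m" using assms by (auto simp: m_def)
  then have "{m..m} \<subseteq> U" by simp
  then have a: "{a..m} \<subseteq> U" and "a \<le> m" unfolding a_def by (rule LeastI, rule Least_le)
  have "Suc x < a" if "x \<in> U" "x < a" for x
  proof (rule ccontr)
    assume "\<not> Suc x < a"
    with that(2) have "a = Suc x" by simp
    then have "{x..m} = insert x {a..m}" using \<open>a \<le> m\<close> by auto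
    then have "{x..m} \<subseteq> U" using a that(1) by simp
    then have "a \<le> x" unfolding a_def by (rule Least_le)
    then show False using that(2) by simp
  qed
  then show thesis
    using a \<open>a \<le> m\<close> m by (intro that[of a "Suc m" "{x \<in> U. x < a}"]) (auto simp: not_less less_Suc_eq_le)
qed

lemma runs_empty: "runs {} = {}"
  by (auto simp: runs_def)

text \<open>Removing the last run splits a factor \<open>e\<^sub>b\<^sub>-\<^sub>a\<close> off the product, and
  splits the labelings accordingly.\<close>

theorem prod_elem_sym_runs:
  assumes "finite U"
  shows "finite (runs U)"
    and "mcoeff (\<Prod>(i, j)\<in>runs U. elem_sym (j - i) :: 'a::comm_ring_1 mseries) M = of_nat (card (labelings U M))"
proof -
  have "finite (runs U) \<and> (\<forall>M. mcoeff (\<Prod>(i, j)\<in>runs U. elem_sym (j - i) :: 'a mseries) M =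
      of_nat (card (labelings U M)))"
    using assms
  proof (induction U rule: finite_psubset_induct)
    case (psubset U)
    show ?case
    proof (cases "U = {}")
      case True
      have "labelings {} M = (if M = {#} then {\<lambda>_. undefined} else {})" for M
        by (auto simp: labelings_def)
      then show ?thesis using True by (simp add: runs_empty mcoeff_one)
    next
      case False
      then obtain a b U' where ab: "a < b" "U = {a..<b} \<union> U'" "U' \<subset> U" "\<And>x. x \<in> U' \<Longrightarrow> Suc x < a"
        using last_run[OF psubset.hyps] by metis
      have fin: "finite U'" using ab(3) psubset.hyps by (meson finite_subset psubset_imp_subset)
      note IH = psubset.IH[OF ab(3)]
      note runs = runs_union[OF ab(1,4)]
      have "mcoeff (\<Prod>(i, j)\<in>runs U. elem_sym (j - i) :: 'a mseries) M = of_nat (card (labelings U M))" for M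
      proof -
        have "mcoeff (\<Prod>(i, j)\<in>runs U. elem_sym (j - i) :: 'a mseries) M =
            mcoeff (elem_sym (b - a) * (\<Prod>(i, j)\<in>runs U'. elem_sym (j - i) :: 'a mseries)) M"
          using IH runs by (simp add: ab(2))
        also have "\<dots> = (\<Sum>(A, B)\<in>splits M. of_nat (card (labelings {a..<b} A) * card (labelings U' B)))"
          unfolding mcoeff_mult
          by (rule sum.cong) (use IH in \<open>auto simp: elem_sym.rep_eq labelings_interval\<close>)
        also have "\<dots> = of_nat (card (labelings U M))"
          using labelings_union[OF fin ab(4), of b M] by (simp add: ab(2) case_prod_unfold)
        finally show ?thesis .
      qed
      then show ?thesis using IH runs by (simp add: ab(2))
    qed
  qed
  then show "finite (runs U)" "mcoeff (\<Prod>(i, j)\<in>runs U. elem_sym (j - i) :: 'a mseries) M = of_nat (card (labelings U M))"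
    by blast+
qed

lemma finite_up_steps: "finite (up_steps ps)"
  by (rule finite_subset[of _ "{..<length ps}"]) (auto simp: up_steps_def)

lemma risers_eq_runs: "risers ps = runs (up_steps ps)"
  by (simp add: risers_def runs_def)

lemma mcoeff_path_weight:
  "mcoeff (path_weight ps :: 'a::comm_ring_1 mseries) M = of_nat (card (labelings (up_steps ps) M))"
proof -
  have "path_weight ps = (\<Prod>(i, j)\<in>runs (up_steps ps). elem_sym (j - i) :: 'a mseries)"
    by (simp add: path_weight_def riser_lengths_def risers_eq_runs prod_unfold_prod_mset
        image_mset.compositionality o_def case_prod_unfold)
  then show ?thesis
    by (simp only: prod_elem_sym_runs(2)[OF finite_up_steps])
qed

lemma path_weight_in_power_sum_span: "(path_weight ps :: 'a::rational_domain mseries) \<in> power_sum_span"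
proof -
  have "(\<Prod>k\<in>#R. elem_sym k :: 'a mseries) \<in> power_sum_span" for R
    by (induction R) (simp_all add: power_sum_span_one power_sum_span_mult elem_sym_in_power_sum_span)
  then show ?thesis by (simp add: path_weight_def)
qed


section \<open>Labelled paths as words\<close>

text \<open>The letter of an up step carries its label, so that a word is a path together with a
  labeling, and a change of the path can be described by recursion on the word.\<close>

datatype step = is_Up: Up (label: nat) | Diagonal | East

fun displacement :: "step \<Rightarrow> nat \<times> nat" where
  "displacement (Up _) = (0, 1)"
| "displacement Diagonal = (1, 1)"
| "displacement East = (1, 0)"

fun points :: "nat \<times> nat \<Rightarrow> step list \<Rightarrow> (nat \<times> nat) list" where
  "points p [] = [p]"
| "points p (s # w) = p # points (p + displacement s) w"

fun label_mset :: "step list \<Rightarrow> nat multiset" where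
  "label_mset [] = {#}"
| "label_mset (Up a # w) = add_mset a (label_mset w)"
| "label_mset (_ # w) = label_mset w"

text \<open>The condition on two consecutive letters in a word with labels increasing along the
  risers.\<close>

definition rises :: "step \<Rightarrow> step \<Rightarrow> bool" where
  "rises s t \<longleftrightarrow> is_Up s \<and> is_Up t \<longrightarrow> label s < label t"

abbreviation increasing :: "step list \<Rightarrow> bool" where
  "increasing \<equiv> successively rises"

lemma displacement_eq_iff: "displacement s = displacement t \<longleftrightarrow> s = t \<or> is_Up s \<and> is_Up t"
  by (cases s; cases t) auto

lemma is_Up_iff: "is_Up s \<longleftrightarrow> displacement s = (0, 1)"
  by (cases s) auto

lemma Diagonal_iff: "s = Diagonal \<longleftrightarrow> displacement s = (1, 1)"
  by (cases s) auto

lemma points_neq_Nil [simp]: "points p w \<noteq> []"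
  by (cases w) auto

lemma hd_points [simp]: "hd (points p w) = p"
  by (cases w) auto

lemma length_points [simp]: "length (points p w) = Suc (length w)"
  by (induction w arbitrary: p) auto

lemma points_nth_0 [simp]: "points p w ! 0 = p"
  by (cases w) auto

lemma points_nth_Suc: "i < length w \<Longrightarrow> points p w ! Suc i = points p w ! i + displacement (w ! i)"
  by (induction w arbitrary: p i) (auto simp: nth_Cons split: nat.splits)

lemma points_cong: "map displacement w = map displacement w' \<Longrightarrow> points p w = points p w'"
proof (induction w arbitrary: p w')
  case (Cons s w)
  then obtain t v where w': "w' = t # v" by (cases w') auto
  then have "points q w = points q v" for q using Cons.prems by (intro Cons.IH) simp
  then show ?case using Cons.prems w' by simp
qed simp

lemma points_eq_imp_displacement_eq:
  assumes "points p w = points p w'"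
  shows "map displacement w = map displacement w'"
proof (rule nth_equalityI)
  show len: "length (map displacement w) = length (map displacement w')"
    using arg_cong[OF assms, of length] by simp
  fix i assume "i < length (map displacement w)"
  then have i: "i < length w" "i < length w'" using len by auto
  have "points p w ! i + displacement (w ! i) = points p w ! i + displacement (w' ! i)"
    using points_nth_Suc[OF i(1), of p] points_nth_Suc[OF i(2), of p] by (metis assms)
  then show "map displacement w ! i = map displacement w' ! i"
    using i by (simp only: nth_map add_left_cancel)
qed

lemma up_steps_points: "up_steps (points p w) = {i. i < length w \<and> is_Up (w ! i)}"
  by (auto simp: up_steps_def points_nth_Suc is_Up_iff)

lemma diag_steps_points: "diag_steps (points p w) = {i. i < length w \<and> w ! i = Diagonal}"
  by (auto simp: diag_steps_def points_nth_Suc Diagonal_iff)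

lemma diag_points: "diag (points p w) = count_list w Diagonal"
  unfolding diag_def diag_steps_points count_list_eq_length_filter length_filter_conv_card
  by (intro arg_cong[where f = card]) auto

lemma label_mset_nth: "label_mset w = image_mset (\<lambda>i. label (w ! i)) (mset_set {i. i < length w \<and> is_Up (w ! i)})"
proof -
  have "label_mset w = image_mset label (filter_mset is_Up (mset w))"
    by (induction w rule: label_mset.induct) auto
  also have "mset w = image_mset (nth w) (mset_set {..<length w})"
    by (metis atLeast_upt map_nth mset_map mset_set_set distinct_upt atLeast0LessThan set_upt)
  finally show ?thesis
    by (simp add: filter_mset_image_mset image_mset.compositionality o_def filter_mset_mset_set lessThan_def
        flip: Collect_conj_eq)
qed

lemma points_surj:
  assumes "ps \<noteq> []"
    "\<forall>i. Suc i < length ps \<longrightarrow> ps ! Suc i \<in> {ps ! i + (0, 1), ps ! i + (1, 1), ps ! i + (1, 0)}"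
  shows "\<exists>w. points (hd ps) w = ps"
  using assms
proof (induction ps)
  case (Cons p ps)
  show ?case
  proof (cases ps)
    case Nil
    then show ?thesis by (auto intro: exI[of _ "[]"])
  next
    case (Cons q qs)
    then have "q \<in> {p + (0, 1), p + (1, 1), p + (1, 0)}"
      using Cons.prems(2)[rule_format, of 0] by simp
    then obtain s where "q = p + displacement s"
      by (metis displacement.simps insertE singletonD)
    moreover have "\<exists>w. points (hd ps) w = ps"
      using Cons Cons.prems(2) by (intro Cons.IH) force+
    ultimately show ?thesis
      using Cons by (auto intro: exI[of _ "s # _"])
  qed
qed simp

text \<open>The words that trace a given path differ only in the labels of their up steps. The word
  \<open>w0\<close> is there to express that \<open>ps\<close> is a path.\<close>

lemma card_labelings_points:
  assumes ps_def: "ps = points p w0"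
  shows "card {w. points p w = ps \<and> increasing w \<and> label_mset w = M} = card (labelings (up_steps ps) M)"
    and "finite {w. points p w = ps \<and> increasing w \<and> label_mset w = M}"
proof -
  let ?W = "{w. points p w = ps \<and> increasing w \<and> label_mset w = M}"
  let ?f = "\<lambda>w. restrict (\<lambda>i. label (w ! i)) (up_steps ps)"
  have bij: "bij_betw ?f ?W (labelings (up_steps ps) M)"
    unfolding bij_betw_def
  proof (intro conjI equalityI subsetI)
    show "inj_on ?f ?W"
    proof (rule inj_onI)
      fix w w' assume w: "w \<in> ?W" and w': "w' \<in> ?W" and eq: "?f w = ?f w'"
      from w w' have d: "map displacement w = map displacement w'"
        by (intro points_eq_imp_displacement_eq[of p]) simp
      show "w = w'"
      proof (rule nth_equalityI)
        show len: "length w = length w'" using d by (rule map_eq_imp_length_eq)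
        fix i assume i: "i < length w"
        then have "w ! i = w' ! i \<or> is_Up (w ! i) \<and> is_Up (w' ! i)"
          using arg_cong[OF d, of "\<lambda>xs. xs ! i"] len by (simp add: displacement_eq_iff)
        moreover have "label (w ! i) = label (w' ! i)" if "is_Up (w ! i)"
        proof -
          have "i \<in> up_steps (points p w)" using i that by (simp add: up_steps_points)
          then have "i \<in> up_steps ps" using w by simp
          then show ?thesis using fun_cong[OF eq, of i] by simp
        qed
        ultimately show "w ! i = w' ! i" by (metis step.collapse(1))
      qed
    qed
  next
    fix l assume "l \<in> ?f ` ?W"
    then obtain w where w: "points p w = ps" "increasing w" "label_mset w = M" and l: "l = ?f w" by auto
    have up: "up_steps ps = {i. i < length w \<and> is_Up (w ! i)}"
      by (simp add: up_steps_points flip: w(1))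
    have "image_mset l (mset_set (up_steps ps)) = image_mset (\<lambda>i. label (w ! i)) (mset_set (up_steps ps))"
      by (rule image_mset_cong) (simp add: l finite_up_steps)
    also have "\<dots> = M" unfolding up w(3)[symmetric] by (rule label_mset_nth[symmetric])
    finally have "image_mset l (mset_set (up_steps ps)) = M" .
    moreover have "l i < l (Suc i)" if "i \<in> up_steps ps" "Suc i \<in> up_steps ps" for i
      using that w(2) by (auto simp: l up successively_conv_nth rises_def)
    ultimately show "l \<in> labelings (up_steps ps) M"
      by (simp add: labelings_def l)
  next
    fix l assume l: "l \<in> labelings (up_steps ps) M"
    define w where "w = map (\<lambda>i. if is_Up (w0 ! i) then Up (l i) else w0 ! i) [0..<length w0]"
    have len: "length w = length w0" by (simp add: w_def)
    have nth: "w ! i = (if is_Up (w0 ! i) then Up (l i) else w0 ! i)" if "i < length w0" for i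
      using that by (simp add: w_def)
    have "map displacement w = map displacement w0"
      by (rule nth_equalityI) (auto simp: len nth is_Up_iff)
    then have p: "points p w = ps" unfolding ps_def by (rule points_cong)
    have up: "up_steps ps = {i. i < length w \<and> is_Up (w ! i)}"
      by (simp add: up_steps_points flip: p)
    have lab: "label (w ! i) = l i" if "i \<in> up_steps ps" for i
      using that by (auto simp: ps_def up_steps_points nth)
    have "label_mset w = image_mset (\<lambda>i. label (w ! i)) (mset_set (up_steps ps))"
      unfolding up by (rule label_mset_nth)
    also have "\<dots> = image_mset l (mset_set (up_steps ps))"
      by (rule image_mset_cong) (simp add: lab finite_up_steps)
    also have "\<dots> = M" using l by (simp add: labelings_def)
    finally have c: "label_mset w = M" .
    have "rises (w ! i) (w ! Suc i)" if "Suc i < length w" for i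
      unfolding rises_def
    proof (intro impI)
      assume "is_Up (w ! i) \<and> is_Up (w ! Suc i)"
      then have "i \<in> up_steps ps" "Suc i \<in> up_steps ps" using that by (auto simp: up)
      then show "label (w ! i) < label (w ! Suc i)" using l by (simp add: lab labelings_def)
    qed
    then have "increasing w" by (simp add: successively_conv_nth)
    moreover have "l = ?f w"
      using l lab by (auto simp: labelings_def fun_eq_iff extensional_def)
    ultimately show "l \<in> ?f ` ?W" using p c by blast
  qed
  then show "card ?W = card (labelings (up_steps ps) M)" by (rule bij_betw_same_card)
  show "finite ?W" using bij_betw_finite[OF bij] finite_labelings[OF finite_up_steps] by simp
qed


section \<open>The area of a word\<close>

text \<open>The starting points of the steps that go up by one row. As the definition of the area
  reads a path only through these points, their set determines the area.\<close>

fun row_starts :: "nat \<times> nat \<Rightarrow> step list \<Rightarrow> (nat \<times> nat) set" where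
  "row_starts p [] = {}"
| "row_starts p (East # w) = row_starts (p + (1, 0)) w"
| "row_starts p (s # w) = insert p (row_starts (p + displacement s) w)"

lemma row_starts_iff:
  "q \<in> row_starts p w \<longleftrightarrow> (\<exists>j<length w. w ! j \<noteq> East \<and> points p w ! j = q)"
proof (induction p w rule: row_starts.induct)
qed (auto simp: Ex_less_Suc2)

lemma not_East_iff: "s \<noteq> East \<longleftrightarrow> is_Up s \<or> s = Diagonal"
  by (cases s) auto

lemma row_start_points: "row_start (points p w) i = (THE u. (u, i) \<in> row_starts p w)"
proof -
  have "up_steps (points p w) \<union> diag_steps (points p w) = {j. j < length w \<and> w ! j \<noteq> East}"
    unfolding up_steps_points diag_steps_points using not_East_iff by auto
  then have "(\<exists>j\<in>up_steps (points p w) \<union> diag_steps (points p w). points p w ! j = (u, i)) \<longleftrightarrow>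
      (u, i) \<in> row_starts p w" for u
    by (auto simp: row_starts_iff)
  then show ?thesis by (simp add: row_start_def)
qed

lemma area_points_cong:
  "row_starts p w = row_starts p w' \<Longrightarrow> area m n (points p w) = area m n (points p w')"
  by (simp add: area_def row_start_points)


section \<open>Trading diagonal steps for peaks\<close>

text \<open>With \<open>N\<close> larger than all labels of \<open>w\<close>, the diagonal steps can be recovered as the up
  steps labelled \<open>N\<close>.\<close>

fun peaks :: "nat \<Rightarrow> step list \<Rightarrow> step list" where
  "peaks N [] = []"
| "peaks N (Diagonal # w) = Up N # East # peaks N w"
| "peaks N (s # w) = s # peaks N w"

lemma row_starts_peaks: "row_starts p (peaks N w) = row_starts p w"
  by (induction N w arbitrary: p rule: peaks.induct) (simp_all add: add.assoc)

lemma last_points_peaks: "last (points p (peaks N w)) = last (points p w)"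
  by (induction N w arbitrary: p rule: peaks.induct) (simp_all add: add.assoc)

text \<open>The only new points lie one above the starting point of a diagonal step. This keeps them
  inside the region above the line from \<open>(0, 0)\<close> to \<open>(m, n)\<close>.\<close>

lemma set_points_peaks:
  assumes "\<And>u v. P (u, v) \<Longrightarrow> P (u, Suc v)"
  shows "(\<forall>q\<in>set (points p (peaks N w)). P q) \<longleftrightarrow> (\<forall>q\<in>set (points p w). P q)"
proof (induction N w arbitrary: p rule: peaks.induct)
  case (2 N w)
  have "P (p + (0, 1))" if "P p"
    using assms[of "fst p" "snd p"] that by (cases p) simp
  then show ?case using 2[of "p + (1, 1)"] by (auto simp: add.assoc)
qed auto

lemma count_Diagonal_peaks: "count_list (peaks N w) Diagonal = 0"
  by (induction N w rule: peaks.induct) auto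

lemma label_mset_peaks: "label_mset (peaks N w) = label_mset w + replicate_mset (count_list w Diagonal) N"
  by (induction N w rule: peaks.induct) auto

text \<open>A new up step is followed by a right step and has the largest label, so it extends the
  riser before it, if any, in an increasing way.\<close>

lemma increasing_peaks:
  assumes "\<forall>a\<in>#label_mset w. a < N"
  shows "increasing (peaks N w) \<longleftrightarrow> increasing w"
  using assms
proof (induction N w rule: peaks.induct)
  case (2 N w)
  then show ?case by (auto simp: successively_Cons rises_def)
next
  case ("3_1" N a w)
  then show ?case by (cases w rule: label_mset.cases) (auto simp: successively_Cons rises_def)
next
  case ("3_2" N w)
  then show ?case by (auto simp: successively_Cons rises_def)
qed auto

lemma peaks_inj:
  assumes "peaks N w = peaks N w'" "N \<notin># label_mset w" "N \<notin># label_mset w'"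
  shows "w = w'"
  using assms
proof (induction N w arbitrary: w' rule: peaks.induct)
  case (1 N)
  then show ?case by (cases "(N, w')" rule: peaks.cases) auto
next
  case (2 N w)
  then show ?case by (cases "(N, w')" rule: peaks.cases) auto
next
  case ("3_1" N a w)
  then show ?case by (cases "(N, w')" rule: peaks.cases) auto
next
  case ("3_2" N w)
  then show ?case by (cases "(N, w')" rule: peaks.cases) auto
qed

text \<open>In \<open>v\<close>, a letter \<open>Up N\<close> cannot be followed by an up step, since \<open>N\<close> is the largest
  label, nor can it be the last letter. So it is followed by a right step, and the two form the
  image of a diagonal step.\<close>

lemma peaks_surj:
  assumes "Diagonal \<notin> set v" "increasing v" "\<forall>a\<in>#label_mset v. a \<le> N" "v \<noteq> [] \<Longrightarrow> \<not> is_Up (last v)"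
  shows "\<exists>w. peaks N w = v \<and> N \<notin># label_mset w"
  using assms
proof (induction v rule: length_induct)
  case (1 v)
  show ?case
  proof (cases v)
    case Nil
    then show ?thesis by (auto intro: exI[of _ "[]"])
  next
    case (Cons s v')
    show ?thesis
    proof (cases "s = Up N")
      case True
      then obtain t v'' where v': "v' = t # v''"
        using "1.prems"(4) Cons by (cases v') auto
      have "t = East"
        using "1.prems" Cons True v' by (cases t) (auto simp: rises_def)
      then have "\<exists>w. peaks N w = v'' \<and> N \<notin># label_mset w"
        using "1.prems" Cons True v'
        by (intro "1.IH"[rule_format]) (auto simp: successively_Cons split: if_splits)
      then obtain w where "peaks N w = v''" "N \<notin># label_mset w" by blast
      then show ?thesis using Cons True v' \<open>t = East\<close> by (auto intro!: exI[of _ "Diagonal # w"])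
    next
      case False
      have "\<exists>w. peaks N w = v' \<and> N \<notin># label_mset w"
        using "1.prems" Cons
        by (intro "1.IH"[rule_format]) (cases s; auto simp: successively_Cons split: if_splits)+
      then obtain w where "peaks N w = v'" "N \<notin># label_mset w" by blast
      then show ?thesis using Cons False "1.prems"(1) by (cases s) (auto intro!: exI[of _ "s # w"])
    qed
  qed
qed


section \<open>Counting labelled paths\<close>

lemma last_points_snd: "snd (last (points p w)) = snd p + size (label_mset w) + count_list w Diagonal"
  by (induction w arbitrary: p rule: label_mset.induct) auto

lemma length_le_last_points: "fst p + snd p + length w \<le> fst (last (points p w)) + snd (last (points p w))"
proof (induction w arbitrary: p)
  case (Cons s w)
  then show ?case using Cons[of "p + displacement s"] by (cases s) auto
qed simp

lemma points_le_last:
  "q \<in> set (points p w) \<Longrightarrow> fst q \<le> fst (last (points p w)) \<and> snd q \<le> snd (last (points p w))"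
proof (induction w arbitrary: p q)
  case (Cons s w)
  have "p + displacement s \<in> set (points (p + displacement s) w)"
    by (metis hd_in_set hd_points points_neq_Nil)
  then have "fst p \<le> fst (last (points (p + displacement s) w)) \<and> snd p \<le> snd (last (points (p + displacement s) w))"
    using Cons.IH[of "p + displacement s" "p + displacement s"] by simp
  then show ?case using Cons.prems Cons.IH[of q "p + displacement s"] by auto
qed simp

lemma points_in_schroeder_paths:
  "points (0, 0) w \<in> schroeder_paths m n \<longleftrightarrow> last (points (0, 0) w) = (m, n) \<and>
    (\<forall>q\<in>set (points (0, 0) w). int n * int (fst q) \<le> int m * int (snd q))"
proof -
  have "points (0, 0) w ! Suc i \<in> {points (0, 0) w ! i + (0, 1), points (0, 0) w ! i + (1, 1), points (0, 0) w ! i + (1, 0)}"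
    if "Suc i < length (points (0, 0) w)" for i
    using that by (cases "w ! i") (auto simp: points_nth_Suc)
  then show ?thesis
    unfolding schroeder_paths_def by (auto simp: case_prod_unfold)
qed

lemma schroeder_paths_imp_points:
  assumes "ps \<in> schroeder_paths m n"
  obtains w where "ps = points (0, 0) w"
proof -
  have "\<exists>w. points (hd ps) w = ps"
    using assms by (intro points_surj) (auto simp: schroeder_paths_def)
  moreover have "hd ps = (0, 0)" using assms by (simp add: schroeder_paths_def)
  ultimately show thesis using that by metis
qed

lemma finite_schroeder_paths: "finite (schroeder_paths m n)"
proof (rule finite_subset)
  show "schroeder_paths m n \<subseteq> {ps. set ps \<subseteq> {..m} \<times> {..n} \<and> length ps \<le> Suc (m + n)}"
  proof
    fix ps assume ps: "ps \<in> schroeder_paths m n"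
    then obtain w where w: "ps = points (0, 0) w" by (rule schroeder_paths_imp_points)
    have last: "last (points (0, 0) w) = (m, n)" using ps w by (simp add: schroeder_paths_def)
    have "length w \<le> m + n" using length_le_last_points[of "(0, 0)" w] last by simp
    moreover have "set (points (0, 0) w) \<subseteq> {..m} \<times> {..n}"
      using points_le_last[of _ "(0, 0)" w] last by fastforce
    ultimately show "ps \<in> {ps. set ps \<subseteq> {..m} \<times> {..n} \<and> length ps \<le> Suc (m + n)}"
      by (simp add: w)
  qed
  show "finite {ps. set ps \<subseteq> {..m} \<times> {..n} \<and> length ps \<le> Suc (m + n)}"
    by (rule finite_lists_length_le) simp
qed

definition labelled_paths :: "nat \<Rightarrow> nat \<Rightarrow> nat \<Rightarrow> nat multiset \<Rightarrow> step list set" where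
  "labelled_paths m n k M = {w. points (0, 0) w \<in> schroeder_paths m n \<and>
     count_list w Diagonal = k \<and> increasing w \<and> label_mset w = M}"

lemma sum_labelled_paths:
  "(\<Sum>ps | ps \<in> schroeder_paths m n \<and> diag ps = k.
      of_nat (card (labelings (up_steps ps) M)) * q ^ area m n ps) =
    (\<Sum>w\<in>labelled_paths m n k M. (q :: 'a::comm_ring_1) ^ area m n (points (0, 0) w))"
proof -
  let ?T = "{ps \<in> schroeder_paths m n. diag ps = k}"
  let ?fib = "\<lambda>ps. {w. points (0, 0) w = ps \<and> increasing w \<and> label_mset w = M}"
  have fib: "?fib ps = {w \<in> labelled_paths m n k M. points (0, 0) w = ps}" if "ps \<in> ?T" for ps
    using that by (auto simp: labelled_paths_def diag_points)
  have fibre: "card (?fib ps) = card (labelings (up_steps ps) M)" "finite (?fib ps)"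
    if "ps \<in> schroeder_paths m n" for ps
    using that by (auto elim!: schroeder_paths_imp_points intro: card_labelings_points)
  have fin: "finite (labelled_paths m n k M)"
  proof (rule finite_subset)
    show "labelled_paths m n k M \<subseteq> (\<Union>ps\<in>schroeder_paths m n. ?fib ps)"
      by (auto simp: labelled_paths_def)
  qed (simp add: finite_schroeder_paths fibre)
  have "(\<Sum>ps\<in>?T. of_nat (card (labelings (up_steps ps) M)) * q ^ area m n ps) =
      (\<Sum>ps\<in>?T. \<Sum>w | w \<in> labelled_paths m n k M \<and> points (0, 0) w = ps. q ^ area m n (points (0, 0) w))"
  proof (rule sum.cong)
    fix ps assume ps: "ps \<in> ?T"
    then have "card (labelings (up_steps ps) M) = card (?fib ps)"
      using fibre(1) by simp
    then show "of_nat (card (labelings (up_steps ps) M)) * q ^ area m n ps =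
        (\<Sum>w | w \<in> labelled_paths m n k M \<and> points (0, 0) w = ps. q ^ area m n (points (0, 0) w))"
      by (simp add: fib[OF ps])
  qed simp
  also have "\<dots> = (\<Sum>w\<in>labelled_paths m n k M. q ^ area m n (points (0, 0) w))"
    by (rule sum.group)
       (use fin in \<open>auto simp: finite_schroeder_paths labelled_paths_def diag_points\<close>)
  finally show ?thesis .
qed

text \<open>For surjectivity, a path with \<open>m > 0\<close> never ends with an up step: the point before would
  be \<open>(m, n - 1)\<close>, below the line from \<open>(0, 0)\<close> to \<open>(m, n)\<close>.\<close>

lemma bij_betw_peaks:
  assumes "m > 0" "\<forall>a\<in>#M. a < N"
  shows "bij_betw (peaks N) (labelled_paths m n k M) (labelled_paths m n 0 (replicate_mset k N + M))"
proof -
  have valid: "points (0, 0) (peaks N w) \<in> schroeder_paths m n \<longleftrightarrow> points (0, 0) w \<in> schroeder_paths m n" for w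
  proof -
    have "int n * int (fst (u, Suc v)) \<le> int m * int (snd (u, Suc v))"
      if "int n * int (fst (u, v)) \<le> int m * int (snd (u, v))" for u v
      using that by (simp add: distrib_left)
    note set_points_peaks[of "\<lambda>q. int n * int (fst q) \<le> int m * int (snd q)", OF this]
    then show ?thesis
      unfolding points_in_schroeder_paths last_points_peaks by (simp only:)
  qed
  have NM: "N \<notin># M" using assms(2) by auto
  show ?thesis
    unfolding bij_betw_def
  proof (intro conjI equalityI subsetI)
    show "inj_on (peaks N) (labelled_paths m n k M)"
    proof (rule inj_onI)
      fix w w'
      assume "w \<in> labelled_paths m n k M" "w' \<in> labelled_paths m n k M" "peaks N w = peaks N w'"
      then show "w = w'" using NM by (intro peaks_inj[of N w w']) (simp_all add: labelled_paths_def)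
    qed
  next
    fix v assume "v \<in> peaks N ` labelled_paths m n k M"
    then show "v \<in> labelled_paths m n 0 (replicate_mset k N + M)"
      using assms(2) by (auto simp: labelled_paths_def valid count_Diagonal_peaks label_mset_peaks increasing_peaks)
  next
    fix v assume v: "v \<in> labelled_paths m n 0 (replicate_mset k N + M)"
    have path: "last (points (0, 0) v) = (m, n)"
      "\<And>q. q \<in> set (points (0, 0) v) \<Longrightarrow> int n * int (fst q) \<le> int m * int (snd q)"
      using v by (auto simp: labelled_paths_def points_in_schroeder_paths)
    have "\<not> is_Up (last v)" if "v \<noteq> []"
    proof
      assume up: "is_Up (last v)"
      define q where "q = points (0, 0) v ! (length v - 1)"
      have "(m, n) = q + displacement (last v)"
        using that path(1) points_nth_Suc[of "length v - 1" v "(0, 0)"]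
        by (simp add: last_conv_nth q_def)
      then have "fst q = m" "Suc (snd q) = n"
        using up unfolding is_Up_iff by (metis add.right_neutral fst_add fst_conv,
          metis Suc_eq_plus1 snd_add snd_conv)
      moreover have "q \<in> set (points (0, 0) v)" unfolding q_def by (rule nth_mem) simp
      ultimately have "int (Suc (snd q)) * int m \<le> int m * int (snd q)" using path(2)[of q] by simp
      then show False using assms(1) by (simp add: algebra_simps)
    qed
    moreover have "Diagonal \<notin> set v" using v by (simp add: labelled_paths_def count_list_0_iff)
    moreover have "\<forall>a\<in>#label_mset v. a \<le> N" "increasing v"
      using v assms(2) by (auto simp: labelled_paths_def split: if_splits)
    ultimately obtain w where w: "peaks N w = v" "N \<notin># label_mset w"
      using peaks_surj[of v N] by blast
    have c: "label_mset w + replicate_mset (count_list w Diagonal) N = replicate_mset k N + M"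
      using v label_mset_peaks[of N w] by (simp add: labelled_paths_def w(1))
    have "count_list w Diagonal = k"
      using arg_cong[OF c, of "\<lambda>A. count A N"] NM w(2) by (simp add: not_in_iff)
    moreover from this have "label_mset w = M" using c by simp
    moreover have "points (0, 0) w \<in> schroeder_paths m n" "increasing w"
      using v valid[of w] increasing_peaks[of w N] assms(2) calculation
      by (simp_all add: labelled_paths_def w(1))
    ultimately have "w \<in> labelled_paths m n k M" by (simp add: labelled_paths_def)
    then show "v \<in> peaks N ` labelled_paths m n k M" using w(1) by blast
  qed
qed

lemma mcoeff_C_sym:
  "mcoeff (C_sym m n q) M =
    (\<Sum>w\<in>labelled_paths m n 0 M. (q :: 'a::comm_ring_1) ^ area m n (points (0, 0) w))"
  unfolding sum_labelled_paths[symmetric] C_sym_def mcoeff_sum mcoeff_mconst_mult mcoeff_path_weight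
  by (simp add: mult.commute)

text \<open>Without diagonal steps a path to height \<open>n\<close> has \<open>n\<close> up steps, and the content of a
  labeling has as many elements.\<close>

lemma homogeneous_C_sym: "homogeneous n (C_sym m n q)"
  unfolding homogeneous_def
proof (intro allI impI)
  fix M assume "mcoeff (C_sym m n q) M \<noteq> 0"
  then obtain w where "w \<in> labelled_paths m n 0 M"
    unfolding mcoeff_C_sym by (auto elim: sum.not_neutral_contains_not_neutral)
  then show "size M = n"
    using last_points_snd[of "(0, 0)" w] by (simp add: labelled_paths_def points_in_schroeder_paths)
qed

lemma C_sym_in_power_sum_span: "(C_sym m n q :: 'a::rational_domain mseries) \<in> power_sum_span"
  unfolding C_sym_def
  by (intro power_sum_span_sum power_sum_span_mconst_mult path_weight_in_power_sum_span)

text \<open>The comparison behind both forms of the theorem, with \<open>q\<close> in any domain over \<open>\<rat>\<close> so that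
  it serves over \<open>\<rat>[q]\<close> and \<open>\<rat>[q, y]\<close>. The new label for the peaks is \<open>n + 1\<close>, which exceeds
  the labels \<open>1, \<dots>, n - k\<close> of a parking function.\<close>

lemma sum_parking_functions:
  fixes q :: "'a::rational_domain"
  assumes "m > 0" "k \<le> n"
  shows "(\<Sum>ps | ps \<in> schroeder_paths m n \<and> diag ps = k.
      of_nat (card (parking_functions n ps)) * q ^ area m n ps) =
    hall_inner (C_sym m n q) (power_sum 1 ^ (n - k) * homog_sym k)"
proof -
  let ?M = "mset_set {1..n - k}"
  have "(\<Sum>ps | ps \<in> schroeder_paths m n \<and> diag ps = k.
      of_nat (card (parking_functions n ps)) * q ^ area m n ps) =
    (\<Sum>ps | ps \<in> schroeder_paths m n \<and> diag ps = k.
      of_nat (card (labelings (up_steps ps) ?M)) * q ^ area m n ps)"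
    by (rule sum.cong) (auto simp: parking_functions_eq_labelings finite_up_steps)
  also have "\<dots> = (\<Sum>w\<in>labelled_paths m n k ?M. q ^ area m n (points (0, 0) w))"
    by (rule sum_labelled_paths)
  also have "\<dots> = (\<Sum>w\<in>labelled_paths m n k ?M. q ^ area m n (points (0, 0) (peaks (Suc n) w)))"
    by (intro sum.cong refl arg_cong[of _ _ "\<lambda>a. q ^ a"] area_points_cong row_starts_peaks[symmetric])
  also have "\<dots> = (\<Sum>w\<in>labelled_paths m n 0 (replicate_mset k (Suc n) + ?M). q ^ area m n (points (0, 0) w))"
    by (rule sum.reindex_bij_betw[OF bij_betw_peaks]) (use assms in auto)
  also have "\<dots> = mcoeff (C_sym m n q) (replicate_mset k (Suc n) + ?M)"
    by (rule mcoeff_C_sym[symmetric])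
  also have "\<dots> = hall_inner (C_sym m n q) (power_sum 1 ^ (n - k) * homog_sym k)"
    using hall_inner_homog_sym[OF C_sym_in_power_sum_span, of "{1..n - k}" "Suc n" m n q k] by simp
  finally show ?thesis .
qed

lemma diag_le:
  assumes "ps \<in> schroeder_paths m n"
  shows "diag ps \<le> n"
proof -
  from assms obtain w where w: "ps = points (0, 0) w" by (rule schroeder_paths_imp_points)
  then have "last (points (0, 0) w) = (m, n)" using assms by (simp add: schroeder_paths_def)
  then show ?thesis using last_points_snd[of "(0, 0)" w] by (simp add: w diag_points)
qed

theorem corollary6:
  fixes m n :: nat
  assumes "m > 0" and "n > 0"
  shows "P_poly m n =
           hall_inner (add_variable (C_sym m n [:qvar:]) yvar) (geometric_series (power_sum 1))
       \<and> (\<forall>k\<le>n. coeff (P_poly m n) k =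
           hall_inner (C_sym m n qvar) (power_sum 1 ^ (n - k) * homog_sym k))"
proof (intro conjI allI impI)
  let ?t = "\<lambda>ps. of_nat (card (parking_functions n ps)) * [:qvar:] ^ area m n ps * yvar ^ diag ps"
  have "P_poly m n = (\<Sum>k\<le>n. \<Sum>ps | ps \<in> schroeder_paths m n \<and> diag ps = k. ?t ps)"
    unfolding P_poly_def
    by (rule sum.group[symmetric]) (auto simp: finite_schroeder_paths diag_le)
  also have "\<dots> = (\<Sum>k\<le>n. hall_inner (C_sym m n [:qvar:]) (power_sum 1 ^ (n - k) * homog_sym k) * yvar ^ k)"
  proof (rule sum.cong)
    fix k assume "k \<in> {..n}"
    then have "k \<le> n" by simp
    show "(\<Sum>ps | ps \<in> schroeder_paths m n \<and> diag ps = k. ?t ps) =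
        hall_inner (C_sym m n [:qvar:]) (power_sum 1 ^ (n - k) * homog_sym k) * yvar ^ k"
      unfolding sum_parking_functions[OF assms(1) \<open>k \<le> n\<close>, symmetric] sum_distrib_right
      by (rule sum.cong) auto
  qed simp
  also have "\<dots> = hall_inner (add_variable (C_sym m n [:qvar:]) yvar) (geometric_series (power_sum 1))"
    by (rule hall_inner_add_variable[symmetric]) (rule C_sym_in_power_sum_span homogeneous_C_sym)+
  finally show "P_poly m n = hall_inner (add_variable (C_sym m n [:qvar:]) yvar) (geometric_series (power_sum 1))" .
next
  fix k assume k: "k \<le> n"
  have coeff: "coeff (of_nat c * [:qvar:] ^ a * yvar ^ d) k = (if d = k then of_nat c * qvar ^ a else 0)"
    for c a d :: nat
  proof -
    have "of_nat c * [:qvar:] ^ a * yvar ^ d = monom (of_nat c * qvar ^ a) d"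
      by (simp add: yvar_def monom_power of_nat_poly poly_const_pow smult_monom)
    then show ?thesis by simp
  qed
  have "coeff (P_poly m n) k = (\<Sum>ps\<in>schroeder_paths m n. if diag ps = k
      then of_nat (card (parking_functions n ps)) * qvar ^ area m n ps else 0)"
    by (simp only: P_poly_def coeff_sum coeff)
  also have "\<dots> = (\<Sum>ps | ps \<in> schroeder_paths m n \<and> diag ps = k.
      of_nat (card (parking_functions n ps)) * qvar ^ area m n ps)"
    by (rule sum.inter_filter[symmetric]) (rule finite_schroeder_paths)
  also have "\<dots> = hall_inner (C_sym m n qvar) (power_sum 1 ^ (n - k) * homog_sym k)"
    by (rule sum_parking_functions[OF assms(1) k])
  finally show "coeff (P_poly m n) k = hall_inner (C_sym m n qvar) (power_sum 1 ^ (n - k) * homog_sym k)" .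
qed

end
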